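(* Let $k \geq 2$ and let $\alpha,\beta \in (0,1)$ satisfy $\beta = \frac{k\alpha}{1+(k-1)\alpha}$. If $\alpha$ and $\beta$ are not computable reals, then $(\alpha,\beta) \notin \mathsf{EXT^{p}}(k)$, and a fortiori $(\alpha,\beta)\notin\mathsf{EXT}(k)$.
   Context: $C$ denotes plain Kolmogorov complexity: $C(\sigma)=\min\{|p|:\mathbb{U}(p)=\sigma\}$ for a fixed optimal machine $\mathbb{U}$. For $k \geq 1$, $\mathsf{EXT^{p}}(k)$ is the set of pairs $(\alpha,\beta)\in[0,1]^2$ for which there exist a total one-to-one computable $f:\mathbb{N}\to\mathbb{N}$, partial computable $\Gamma_1,\ldots,\Gamma_k:\{0,1\}^*\to\{0,1\}^*$ and $d\in\mathbb{N}$ such that for all $n$ and every $\sigma$ with $|\sigma|=f(n)$: $|\Gamma_i(\sigma)|=n$ for every $i$ with $\Gamma_i(\sigma)$ defined, and if $C(\sigma)\ge\alpha|\sigma|+d$ then for some $i$, $\Gamma_i(\sigma)$ is defined and $C(\Gamma_i(\sigma))\ge\beta|\Gamma_i(\sigma)|-d$. $\mathsf{EXT}(k)$ is defined identically except that $\Gamma_1,\ldots,\Gamma_k$ are required to be total computable functions. (Given the relation between $\alpha$ and $\beta$, they are either both computable or both non-computable.) *)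

theory Defs
  imports Complex_Main "HOL-Library.Nat_Bijection"
begin

text \<open>
  Partial recursive functions of one argument; several arguments are passed through the pairing
  \<^const>\<open>prod_encode\<close>. The class is the closure of zero, successor and the two projections under
  pairing, composition, primitive recursion and unbounded minimisation; all schemes are strict.
\<close>

primrec prim_recursion ::
  "(nat \<Rightarrow> nat option) \<Rightarrow> (nat \<Rightarrow> nat option) \<Rightarrow> nat \<Rightarrow> nat \<Rightarrow> nat option" where
  "prim_recursion f g a 0 = f a"
| "prim_recursion f g a (Suc n) =
     Option.bind (prim_recursion f g a n) (\<lambda>r. g (prod_encode (a, prod_encode (n, r))))"

definition is_mu :: "(nat \<Rightarrow> nat option) \<Rightarrow> nat \<Rightarrow> nat \<Rightarrow> bool" where
  "is_mu f a n \<longleftrightarrow> f (prod_encode (a, n)) = Some 0 \<and>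
     (\<forall>m<n. \<exists>v. f (prod_encode (a, m)) = Some (Suc v))"

definition minimisation :: "(nat \<Rightarrow> nat option) \<Rightarrow> nat \<Rightarrow> nat option" where
  "minimisation f a = (if \<exists>n. is_mu f a n then Some (LEAST n. is_mu f a n) else None)"

inductive partial_recursive :: "(nat \<Rightarrow> nat option) \<Rightarrow> bool" where
  zero: "partial_recursive (\<lambda>_. Some 0)"
| succ: "partial_recursive (\<lambda>n. Some (Suc n))"
| left: "partial_recursive (\<lambda>n. Some (fst (prod_decode n)))"
| right: "partial_recursive (\<lambda>n. Some (snd (prod_decode n)))"
| pair: "partial_recursive f \<Longrightarrow> partial_recursive g \<Longrightarrow>
    partial_recursive (\<lambda>n. Option.bind (f n) (\<lambda>x. Option.bind (g n) (\<lambda>y. Some (prod_encode (x, y)))))"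
| comp: "partial_recursive f \<Longrightarrow> partial_recursive g \<Longrightarrow>
    partial_recursive (\<lambda>n. Option.bind (g n) f)"
| prec: "partial_recursive f \<Longrightarrow> partial_recursive g \<Longrightarrow>
    partial_recursive (\<lambda>n. prim_recursion f g (fst (prod_decode n)) (snd (prod_decode n)))"
| mu: "partial_recursive f \<Longrightarrow> partial_recursive (minimisation f)"

definition computable_nat :: "(nat \<Rightarrow> nat) \<Rightarrow> bool" where
  "computable_nat f \<longleftrightarrow> partial_recursive (\<lambda>n. Some (f n))"

text \<open>Bijective base-2 numeration, least significant digit first.\<close>

primrec str_code :: "bool list \<Rightarrow> nat" where
  "str_code [] = 0"
| "str_code (b # s) = 2 * str_code s + (if b then 2 else 1)"

lemma bij_str_code: "bij str_code"
proof (rule bijI)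
  show "inj str_code"
  proof (rule injI)
    fix s t show "str_code s = str_code t \<Longrightarrow> s = t"
    proof (induction s arbitrary: t)
      case Nil
      then show ?case by (cases t) (auto split: if_splits)
    next
      case (Cons b s)
      then obtain c u where t: "t = c # u" by (cases t) (auto split: if_splits)
      have "b = c \<and> str_code s = str_code u"
        using Cons.prems unfolding t by (cases b; cases c; simp; presburger)
      then show ?case using Cons.IH t by simp
    qed
  qed
  have "\<exists>s. n = str_code s" for n
  proof (induction n rule: less_induct)
    case (less n)
    show ?case
    proof (cases "n = 0")
      case True
      then show ?thesis by (metis str_code.simps(1))
    next
      case False
      then have "(n - 1) div 2 < n" by linarith
      then obtain s where "(n - 1) div 2 = str_code s" using less by blast
      with False have "n = str_code (even n # s)"
        by (cases "even n"; simp; presburger)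
      then show ?thesis by blast
    qed
  qed
  then show "surj str_code" by (auto simp: surj_def)
qed

definition partial_computable :: "(bool list \<Rightarrow> bool list option) \<Rightarrow> bool" where
  "partial_computable g \<longleftrightarrow>
     (\<exists>h. partial_recursive h \<and> (\<forall>s. h (str_code s) = map_option str_code (g s)))"

definition total_computable :: "(bool list \<Rightarrow> bool list option) \<Rightarrow> bool" where
  "total_computable g \<longleftrightarrow> partial_computable g \<and> (\<forall>s. g s \<noteq> None)"

definition optimal_machine :: "(bool list \<Rightarrow> bool list option) \<Rightarrow> bool" where
  "optimal_machine U \<longleftrightarrow> partial_computable U \<and>
     (\<forall>M. partial_computable M \<longrightarrow>
        (\<exists>c. \<forall>p s. M p = Some s \<longrightarrow> (\<exists>q. U q = Some s \<and> length q \<le> length p + c)))"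

definition plain_complexity :: "(bool list \<Rightarrow> bool list option) \<Rightarrow> bool list \<Rightarrow> nat" where
  "plain_complexity U s = (LEAST l. \<exists>p. U p = Some s \<and> length p = l)"

definition computable_real :: "real \<Rightarrow> bool" where
  "computable_real x \<longleftrightarrow>
     (\<exists>a b. computable_nat a \<and> computable_nat b \<and>
        (\<forall>n. \<bar>x - of_int (int_decode (a n)) / of_nat (Suc (b n))\<bar> \<le> 1 / 2 ^ n))"

definition extracts :: "(bool list \<Rightarrow> bool list option) \<Rightarrow> nat \<Rightarrow> real \<Rightarrow> real \<Rightarrow>
    (nat \<Rightarrow> nat) \<Rightarrow> (nat \<Rightarrow> bool list \<Rightarrow> bool list option) \<Rightarrow> nat \<Rightarrow> bool" where
  "extracts U k \<alpha> \<beta> f \<Gamma> d \<longleftrightarrow>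
     (\<forall>n \<sigma>. length \<sigma> = f n \<longrightarrow>
        (\<forall>i\<in>{1..k}. \<forall>\<tau>. \<Gamma> i \<sigma> = Some \<tau> \<longrightarrow> length \<tau> = n) \<and>
        (real (plain_complexity U \<sigma>) \<ge> \<alpha> * real (length \<sigma>) + real d \<longrightarrow>
          (\<exists>i\<in>{1..k}. \<exists>\<tau>. \<Gamma> i \<sigma> = Some \<tau> \<and>
             real (plain_complexity U \<tau>) \<ge> \<beta> * real (length \<tau>) - real d)))"

definition EXTp :: "(bool list \<Rightarrow> bool list option) \<Rightarrow> nat \<Rightarrow> (real \<times> real) set" where
  "EXTp U k = {(\<alpha>, \<beta>). \<alpha> \<in> {0..1} \<and> \<beta> \<in> {0..1} \<and>
     (\<exists>f \<Gamma> d. inj f \<and> computable_nat f \<and> (\<forall>i\<in>{1..k}. partial_computable (\<Gamma> i)) \<and>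
        extracts U k \<alpha> \<beta> f \<Gamma> d)}"

definition EXT :: "(bool list \<Rightarrow> bool list option) \<Rightarrow> nat \<Rightarrow> (real \<times> real) set" where
  "EXT U k = {(\<alpha>, \<beta>). \<alpha> \<in> {0..1} \<and> \<beta> \<in> {0..1} \<and>
     (\<exists>f \<Gamma> d. inj f \<and> computable_nat f \<and> (\<forall>i\<in>{1..k}. total_computable (\<Gamma> i)) \<and>
        extracts U k \<alpha> \<beta> f \<Gamma> d)}"

end

theory Submission
  imports Defs
begin

text \<open>
  Suppose \<open>f\<close> and \<open>\<Gamma>\<^sub>1, \<dots>, \<Gamma>\<^sub>k\<close> witness \<open>(\<alpha>, \<beta>) \<in> EXTp U k\<close>, and write \<open>m = f n\<close>.

  An input of length \<open>m\<close> and complexity about \<open>\<alpha> m\<close> has an output of complexity at least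
  \<open>\<beta> n - O(1)\<close>, and outputs are not more complex than inputs; so \<open>\<beta> n \<le> \<alpha> m + O(log n)\<close>.

  Conversely, an adversary builds a set \<open>B\<close> of about \<open>2 ^ (\<beta> n)\<close> strings of length \<open>n\<close> that, being
  found effectively, all have complexity below \<open>\<beta> n - d\<close>. Whenever a substantial part of the inputs
  caught so far has a further \<open>\<Gamma>\<^sub>i\<close> defined, the most popular values of \<open>\<Gamma>\<^sub>i\<close> are added to \<open>B\<close>, which
  keeps a fraction of about \<open>2 ^ (\<beta> n - n)\<close> of the caught inputs. After at most \<open>k\<close> rounds there remain
  about \<open>2 ^ (m - k (1 - \<beta>) n)\<close> inputs all of whose defined outputs lie in \<open>B\<close>. Each of these has
  complexity below \<open>\<alpha> m + d\<close>, and counting gives \<open>(1 - \<alpha>) m \<le> k (1 - \<beta>) n + O(log n)\<close>. Only the set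
  of indices \<open>i\<close> that are used is needed as advice, so the partiality of the \<open>\<Gamma>\<^sub>i\<close> does no harm.

  For \<open>\<beta> = k \<alpha> / (1 + (k - 1) \<alpha>)\<close> the two bounds have the same slope and pin \<open>n / m\<close> down to
  \<open>(1 + (k - 1) \<alpha>) / k\<close> up to an error \<open>O(log n / n)\<close>. Since \<open>f\<close> is computable, so is \<open>\<alpha>\<close>.
\<close>

subsection \<open>Closure properties of computable functions\<close>

lemma computable_nat_comp:
  "computable_nat f \<Longrightarrow> computable_nat g \<Longrightarrow> computable_nat (\<lambda>x. f (g x))"
  unfolding computable_nat_def by (drule (1) partial_recursive.comp) simp

lemma computable_nat_pair:
  "computable_nat f \<Longrightarrow> computable_nat g \<Longrightarrow> computable_nat (\<lambda>x. prod_encode (f x, g x))"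
  unfolding computable_nat_def by (drule (1) partial_recursive.pair) simp

lemma computable_nat_fst: "computable_nat f \<Longrightarrow> computable_nat (\<lambda>x. fst (prod_decode (f x)))"
  by (rule computable_nat_comp[of "\<lambda>n. fst (prod_decode n)"])
    (simp_all add: computable_nat_def partial_recursive.left)

lemma computable_nat_snd: "computable_nat f \<Longrightarrow> computable_nat (\<lambda>x. snd (prod_decode (f x)))"
  by (rule computable_nat_comp[of "\<lambda>n. snd (prod_decode n)"])
    (simp_all add: computable_nat_def partial_recursive.right)

lemma computable_nat_Suc: "computable_nat f \<Longrightarrow> computable_nat (\<lambda>x. Suc (f x))"
  by (rule computable_nat_comp[of Suc]) (simp_all add: computable_nat_def partial_recursive.succ)

lemma computable_nat_id: "computable_nat (\<lambda>x. x)"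
proof -
  have "computable_nat (\<lambda>x. prod_encode (fst (prod_decode x), snd (prod_decode x)))"
    unfolding computable_nat_def using partial_recursive.pair[OF partial_recursive.left partial_recursive.right]
    by simp
  then show ?thesis by simp
qed

lemma computable_nat_const: "computable_nat (\<lambda>x. c)"
proof (induction c)
  case 0
  show ?case unfolding computable_nat_def by (rule partial_recursive.zero)
next
  case (Suc c)
  then show ?case by (rule computable_nat_Suc)
qed

definition computable_nat2 :: "(nat \<Rightarrow> nat \<Rightarrow> nat) \<Rightarrow> bool" where
  "computable_nat2 F \<longleftrightarrow> computable_nat (\<lambda>p. F (fst (prod_decode p)) (snd (prod_decode p)))"

lemma computable_nat2_apply:
  assumes "computable_nat2 F" "computable_nat f" "computable_nat g"
  shows "computable_nat (\<lambda>x. F (f x) (g x))"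
  using computable_nat_comp[OF assms(1)[unfolded computable_nat2_def] computable_nat_pair[OF assms(2,3)]]
  by simp

text \<open>The nested projections in the premise on \<open>G\<close> follow the format
  \<open>(a, (n, r))\<close> in which \<open>prim_recursion\<close> passes its arguments. Base and
  step are total, so the strict scheme never yields \<open>None\<close>.\<close>

lemma computable_nat2_rec:
  assumes f: "computable_nat f"
    and G: "computable_nat (\<lambda>p. G (fst (prod_decode p)) (fst (prod_decode (snd (prod_decode p))))
                                (snd (prod_decode (snd (prod_decode p)))))"
    and 0: "\<And>a. F a 0 = f a"
    and S: "\<And>a n. F a (Suc n) = G a n (F a n)"
  shows "computable_nat2 F"
proof -
  let ?G = "\<lambda>p. G (fst (prod_decode p)) (fst (prod_decode (snd (prod_decode p))))
                                (snd (prod_decode (snd (prod_decode p))))"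
  have eq: "prim_recursion (\<lambda>n. Some (f n)) (\<lambda>n. Some (?G n)) a n = Some (F a n)" for a n
    by (induction n) (simp_all add: 0 S)
  show ?thesis
    using partial_recursive.prec[OF f[unfolded computable_nat_def] G[unfolded computable_nat_def]]
    unfolding computable_nat2_def computable_nat_def eq .
qed

lemma computable_nat_add:
  assumes "computable_nat f" "computable_nat g" shows "computable_nat (\<lambda>x. f x + g x)"
proof -
  have "computable_nat2 (+)"
    by (rule computable_nat2_rec[where f = "\<lambda>a. a" and G = "\<lambda>a n r. Suc r"])
      (simp_all add: computable_nat_id computable_nat_Suc computable_nat_snd)
  from computable_nat2_apply[OF this assms] show ?thesis .
qed

lemma computable_nat_mult:
  assumes "computable_nat f" "computable_nat g" shows "computable_nat (\<lambda>x. f x * g x)"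
proof -
  have "computable_nat2 (*)"
    by (rule computable_nat2_rec[where f = "\<lambda>a. 0" and G = "\<lambda>a n r. a + r"])
      (simp_all add: computable_nat_id computable_nat_const computable_nat_add computable_nat_snd computable_nat_fst)
  from computable_nat2_apply[OF this assms] show ?thesis .
qed

lemma computable_nat_power:
  assumes "computable_nat f" "computable_nat g" shows "computable_nat (\<lambda>x. f x ^ g x)"
proof -
  have "computable_nat2 (^)"
    by (rule computable_nat2_rec[where f = "\<lambda>a. 1" and G = "\<lambda>a n r. a * r"])
      (simp_all add: computable_nat_id computable_nat_const computable_nat_mult computable_nat_snd computable_nat_fst)
  from computable_nat2_apply[OF this assms] show ?thesis .
qed

lemma computable_nat_diff:
  assumes "computable_nat f" "computable_nat g" shows "computable_nat (\<lambda>x. f x - g x)"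
proof -
  \<comment> \<open>The step function returns the counter and drops the previous value; this gives
    the predecessor, which truncated subtraction then iterates.\<close>
  have "computable_nat2 (\<lambda>_ n. n - 1)"
    by (rule computable_nat2_rec[where f = "\<lambda>a. 0" and G = "\<lambda>a n r. n"])
      (simp_all add: computable_nat_id computable_nat_const computable_nat_snd computable_nat_fst)
  note pred = computable_nat2_apply[OF this computable_nat_const]
  have "computable_nat2 (-)"
    by (rule computable_nat2_rec[where f = "\<lambda>a. a" and G = "\<lambda>a n r. r - 1"])
      (simp_all add: pred computable_nat_id computable_nat_snd computable_nat_fst del: One_nat_def)
  from computable_nat2_apply[OF this assms] show ?thesis .
qed

text \<open>Bounded sums are the main tool below: bounded quantifiers, quotients, exponents and
  stagewise minimisation are all written in this form.\<close>

lemma computable_nat_sum: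
  assumes "computable_nat2 F" "computable_nat g"
  shows "computable_nat (\<lambda>x. \<Sum>j<g x. F x j)"
proof -
  have "computable_nat2 (\<lambda>x n. \<Sum>j<n. F x j)"
    by (rule computable_nat2_rec[where f = "\<lambda>a. 0" and G = "\<lambda>a n r. r + F a n"])
      (intro computable_nat_const computable_nat_add computable_nat2_apply[OF assms(1)] computable_nat_id
          computable_nat_snd computable_nat_fst | simp)+
  from computable_nat2_apply[OF this computable_nat_id assms(2)] show ?thesis .
qed

section \<open>Decidable predicates and bounded quantifiers\<close>

definition decidable :: "(nat \<Rightarrow> bool) \<Rightarrow> bool" where
  "decidable P \<longleftrightarrow> computable_nat (\<lambda>x. of_bool (P x))"

lemma decidable_le:
  assumes "computable_nat f" "computable_nat g" shows "decidable (\<lambda>x. f x \<le> g x)"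
proof -
  have "of_bool (f x \<le> g x) = 1 - (f x - g x)" for x by simp
  then show ?thesis unfolding decidable_def
    by (simp only:) (intro computable_nat_diff computable_nat_const assms)
qed

lemma decidable_not:
  assumes "decidable P" shows "decidable (\<lambda>x. \<not> P x)"
proof -
  have "of_bool (\<not> P x) = 1 - (of_bool (P x) :: nat)" for x by simp
  then show ?thesis using assms unfolding decidable_def
    by (simp only:) (intro computable_nat_diff computable_nat_const)
qed

lemma decidable_conj:
  assumes "decidable P" "decidable Q" shows "decidable (\<lambda>x. P x \<and> Q x)"
proof -
  have "of_bool (P x \<and> Q x) = of_bool (P x) * (of_bool (Q x) :: nat)" for x by simp
  then show ?thesis using assms unfolding decidable_def
    by (simp only:) (intro computable_nat_mult)
qed

lemma decidable_eq:
  assumes "computable_nat f" "computable_nat g" shows "decidable (\<lambda>x. f x = g x)"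
  unfolding order_eq_iff[of "f _"] by (intro decidable_conj decidable_le assms)

lemma decidable_ball_less:
  assumes "decidable (\<lambda>p. P (fst (prod_decode p)) (snd (prod_decode p)))" "computable_nat g"
  shows "decidable (\<lambda>x. \<forall>j<g x. P x j)"
proof -
  have eq: "(\<forall>j<n. Q j) \<longleftrightarrow> (\<Sum>j<n. of_bool (\<not> Q j)) = (0::nat)" for n :: nat and Q by auto
  show ?thesis unfolding eq
    by (intro decidable_eq computable_nat_sum computable_nat_const assms(2))
      (use decidable_not[OF assms(1)] in \<open>simp add: computable_nat2_def decidable_def\<close>)
qed

lemma decidable_bex_less:
  assumes "decidable (\<lambda>p. P (fst (prod_decode p)) (snd (prod_decode p)))" "computable_nat g"
  shows "decidable (\<lambda>x. \<exists>j<g x. P x j)"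
  using decidable_not[OF decidable_ball_less[OF decidable_not[OF assms(1)] assms(2)]] by simp

lemma decidable_Ball_finite:
  assumes "finite S" "\<And>i. i \<in> S \<Longrightarrow> decidable (P i)"
  shows "decidable (\<lambda>x. \<forall>i\<in>S. P i x)"
  using assms
proof (induction S)
  case empty
  show ?case by (simp add: decidable_def computable_nat_const)
next
  case (insert i S)
  then show ?case using decidable_conj[of "P i" "\<lambda>x. \<forall>i\<in>S. P i x"] by simp
qed

lemma computable_nat_if:
  assumes "decidable P" "computable_nat f" "computable_nat g"
  shows "computable_nat (\<lambda>x. if P x then f x else g x)"
proof -
  have "(if P x then f x else g x) = of_bool (P x) * f x + of_bool (\<not> P x) * g x" for x by simp
  then show ?thesis
    using assms decidable_not[OF assms(1)] unfolding decidable_def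
    by (simp only:) (intro computable_nat_add computable_nat_mult)
qed

lemmas computable_intros =
  computable_nat_id computable_nat_const computable_nat_Suc computable_nat_pair computable_nat_fst
  computable_nat_snd computable_nat_add computable_nat_mult computable_nat_power
  computable_nat_diff computable_nat_if decidable_le decidable_not decidable_conj decidable_eq

lemma computable_nat_of_bool: "decidable P \<Longrightarrow> computable_nat (\<lambda>x. of_bool (P x))"
  by (simp add: decidable_def)

section \<open>Quotients, exponents of two and binary logarithms\<close>

lemma card_lessThan_sum:
  "card {j. j < (n::nat) \<and> P j} = (\<Sum>j<n. of_bool (P j))"
  by (simp add: sum.If_cases Int_def)

lemma initial_segment_lessThan: "e < N \<Longrightarrow> {j. j < N \<and> j < e} = {..<e}" for e N :: nat
  by auto

text \<open>For \<open>n > 0\<close> the quotient \<open>m div n\<close> counts the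
  \<open>j < m\<close> with \<open>Suc j * n \<le> m\<close>. For \<open>n = 0\<close> this count
  would be \<open>m\<close> instead of \<open>0\<close>, hence the separate case.\<close>

lemma computable_nat_div:
  assumes "computable_nat f" "computable_nat g" shows "computable_nat (\<lambda>x. f x div g x)"
proof -
  have eq: "m div n = (if n = 0 then 0 else \<Sum>j<m. of_bool (Suc j * n \<le> m))" for m n :: nat
  proof (cases "n = 0")
    case False
    have "{j. j < m \<and> Suc j * n \<le> m} = {..<m div n}"
    proof (intro set_eqI iffI)
      fix j assume "j \<in> {j. j < m \<and> Suc j * n \<le> m}"
      then have "Suc j * n \<le> m" by blast
      then have "Suc j \<le> m div n" using False less_eq_div_iff_mult_less_eq[of n "Suc j" m] by blast
      then show "j \<in> {..<m div n}" by simp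
    next
      fix j assume "j \<in> {..<m div n}"
      then have j: "Suc j \<le> m div n" by simp
      then have "Suc j * n \<le> m" using False less_eq_div_iff_mult_less_eq[of n "Suc j" m] by blast
      moreover have "j < m" using j div_le_dividend[of m n] by linarith
      ultimately show "j \<in> {j. j < m \<and> Suc j * n \<le> m}" by blast
    qed
    then show ?thesis using False card_lessThan_sum[of m "\<lambda>j. Suc j * n \<le> m"] by simp
  qed simp
  have "computable_nat2 (div)"
    unfolding computable_nat2_def eq
    by (intro computable_intros computable_nat_sum)
      (unfold computable_nat2_def, intro computable_intros computable_nat_of_bool)
  from computable_nat2_apply[OF this assms] show ?thesis .
qed

lemma computable_nat_mod:
  assumes "computable_nat f" "computable_nat g" shows "computable_nat (\<lambda>x. f x mod g x)"
  unfolding modulo_nat_def by (intro computable_intros computable_nat_div assms)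

text \<open>The 2-adic valuation of a positive \<open>N\<close>, in a form that is visibly
  computable. Together with \<open>div_val2\<close> it recovers \<open>e\<close> and
  \<open>x\<close> from a program \<open>2 ^ e * (2 * x + 1)\<close>.\<close>

definition val2 :: "nat \<Rightarrow> nat" where
  "val2 N = (\<Sum>j<N. of_bool (N mod 2 ^ Suc j = 0))"

lemma val2_eq: "val2 (2 ^ e * (2 * x + 1)) = e"
proof -
  let ?N = "2 ^ e * (2 * x + 1) :: nat"
  have "?N mod 2 ^ Suc j = 0 \<longleftrightarrow> j < e" for j
  proof
    assume "j < e"
    then have "(2::nat) ^ Suc j dvd 2 ^ e" by (intro le_imp_power_dvd) simp
    then show "?N mod 2 ^ Suc j = 0" by (simp only: mod_eq_0_iff_dvd dvd_mult2)
  next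
    assume a: "?N mod 2 ^ Suc j = 0"
    show "j < e"
    proof (rule ccontr)
      assume "\<not> j < e"
      then have "(2::nat) ^ Suc e dvd 2 ^ Suc j" by (intro le_imp_power_dvd) simp
      then have "2 ^ Suc e dvd ?N" using a by (metis dvd_trans mod_eq_0_iff_dvd)
      then have "(2::nat) dvd 2 * x + 1"
        by (metis mult.commute nat_mult_dvd_cancel_disj not_numeral_le_zero power_Suc power_eq_0_iff le_refl zero_neq_numeral)
      then show False by presburger
    qed
  qed
  \<comment> \<open>The summation bound is large enough for every \<open>j < e\<close> to be
    counted.\<close>
  moreover have "e < ?N"
    by (rule order_less_le_trans[OF less_exp[of e]]) simp
  ultimately show ?thesis unfolding val2_def card_lessThan_sum[symmetric]
    by (simp only: initial_segment_lessThan card_lessThan)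
qed

lemma div_val2: "2 ^ e * (2 * x + 1) div 2 ^ Suc e = (x::nat)"
proof -
  have "2 ^ e * (2 * x + 1) div 2 ^ Suc e = (2 * x + 1) div 2" 
    by (metis nat_mult_div_cancel_disj power_Suc2 power_not_zero zero_neq_numeral)
  then show ?thesis by simp
qed

lemma computable_nat_val2:
  assumes "computable_nat f" shows "computable_nat (\<lambda>x. val2 (f x))"
proof -
  have "computable_nat (\<lambda>x. val2 x)" unfolding val2_def
    by (intro computable_nat_sum computable_nat_id)
      (unfold computable_nat2_def, intro computable_nat_of_bool computable_intros computable_nat_mod)
  from computable_nat_comp[OF this assms] show ?thesis .
qed

text \<open>The integer part of the binary logarithm of a positive \<open>x\<close>. It reads
  \<open>l\<close> off a number \<open>2 ^ l + j\<close> with \<open>j < 2 ^ l\<close>, so that the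
  leading bit can carry a length.\<close>

definition lg2 :: "nat \<Rightarrow> nat" where
  "lg2 x = (\<Sum>j<x. of_bool (2 ^ Suc j \<le> x))"

lemma lg2_eq:
  assumes "r < 2 ^ l" shows "lg2 (2 ^ l + r) = l"
proof -
  have "(2::nat) ^ Suc j \<le> 2 ^ l + r \<longleftrightarrow> j < l" for j
  proof
    assume "j < l"
    then have "(2::nat) ^ Suc j \<le> 2 ^ l" by (intro power_increasing) auto
    then show "2 ^ Suc j \<le> 2 ^ l + r" by simp
  next
    assume "2 ^ Suc j \<le> 2 ^ l + r"
    also have "\<dots> < 2 ^ Suc l" using assms by simp
    finally show "j < l" by (metis Suc_less_eq one_less_numeral_iff power_strict_increasing_iff semiring_norm(76))
  qed
  moreover have "l < 2 ^ l + r" using less_exp[of l] by linarith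
  ultimately show ?thesis unfolding lg2_def card_lessThan_sum[symmetric]
    by (simp only: initial_segment_lessThan card_lessThan)
qed

lemma computable_nat_lg2:
  assumes "computable_nat f" shows "computable_nat (\<lambda>x. lg2 (f x))"
proof -
  have "computable_nat (\<lambda>x. lg2 x)" unfolding lg2_def
    by (intro computable_nat_sum computable_nat_id)
      (unfold computable_nat2_def, intro computable_nat_of_bool computable_intros computable_nat_mod)
  from computable_nat_comp[OF this assms] show ?thesis .
qed

subsection \<open>Stagewise evaluation of partial recursive functions\<close>

text \<open>\<open>T x t = 0\<close> means that \<open>h x\<close> has not yet halted at stage \<open>t\<close>, \<open>T x t = Suc y\<close> that it has halted with value \<open>y\<close>.\<close>

definition stages :: "(nat \<Rightarrow> nat option) \<Rightarrow> (nat \<Rightarrow> nat \<Rightarrow> nat) \<Rightarrow> bool" where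
  "stages h T \<longleftrightarrow> computable_nat2 T \<and>
     (\<forall>x y t t'. T x t = Suc y \<longrightarrow> t \<le> t' \<longrightarrow> T x t' = Suc y) \<and>
     (\<forall>x y. h x = Some y \<longleftrightarrow> (\<exists>t. T x t = Suc y))"

lemma stages_mono: "stages h T \<Longrightarrow> T x t = Suc y \<Longrightarrow> t \<le> t' \<Longrightarrow> T x t' = Suc y"
  unfolding stages_def by blast

lemma stages_stable: "stages h T \<Longrightarrow> t \<le> t' \<Longrightarrow> T x t \<noteq> 0 \<Longrightarrow> T x t' = T x t"
  using stages_mono by (metis not0_implies_Suc)

lemma stages_sound: "stages h T \<Longrightarrow> T x t = Suc y \<Longrightarrow> h x = Some y"
  unfolding stages_def by blast

lemma stages_complete: "stages h T \<Longrightarrow> h x = Some y \<Longrightarrow> \<exists>t. T x t = Suc y"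
  unfolding stages_def by blast

lemma stages_computable:
  "stages h T \<Longrightarrow> computable_nat f \<Longrightarrow> computable_nat g \<Longrightarrow> computable_nat (\<lambda>x. T (f x) (g x))"
  unfolding stages_def by (blast intro: computable_nat2_apply)

lemma stages_const:
  assumes "computable_nat f" shows "stages (\<lambda>x. Some (f x)) (\<lambda>x t. Suc (f x))"
proof -
  have "computable_nat (\<lambda>p. Suc (f (fst (prod_decode p))))"
    by (intro computable_nat_Suc computable_nat_comp[OF assms] computable_nat_fst computable_nat_id)
  then show ?thesis by (simp add: stages_def computable_nat2_def)
qed

text \<open>By persistence of halted values both components are available at the later of their two
  halting stages. Subtracting \<open>1\<close> strips the halting mark.\<close>

lemma stages_pair:
  assumes F: "stages f F" and G: "stages g G"
  shows "stages (\<lambda>n. Option.bind (f n) (\<lambda>x. Option.bind (g n) (\<lambda>y. Some (prod_encode (x, y)))))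
    (\<lambda>x t. if F x t = 0 then 0 else if G x t = 0 then 0
           else Suc (prod_encode (F x t - 1, G x t - 1)))" (is "stages ?h ?T")
  unfolding stages_def
proof (intro conjI allI impI iffI)
  show "computable_nat2 ?T" unfolding computable_nat2_def
    by (intro computable_intros stages_computable[OF F] stages_computable[OF G])
next
  fix x y t t' assume "?T x t = Suc y" "t \<le> t'"
  then show "?T x t' = Suc y"
    using stages_stable[OF F \<open>t \<le> t'\<close>, of x] stages_stable[OF G \<open>t \<le> t'\<close>, of x]
    by (auto split: if_splits)
next
  fix x y assume "?h x = Some y"
  then obtain u v where uv: "f x = Some u" "g x = Some v" "y = prod_encode (u, v)"
    by (auto simp: bind_eq_Some_conv)
  obtain t t' where "F x t = Suc u" "G x t' = Suc v"
    using stages_complete[OF F uv(1)] stages_complete[OF G uv(2)] by blast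
  then have "F x (max t t') = Suc u" "G x (max t t') = Suc v"
    by (auto intro: stages_mono[OF F] stages_mono[OF G])
  then show "\<exists>t. ?T x t = Suc y" using uv(3) by (intro exI[of _ "max t t'"]) simp
next
  fix x y assume "\<exists>t. ?T x t = Suc y"
  then obtain t where "?T x t = Suc y" by blast
  then show "?h x = Some y"
    by (cases "F x t"; cases "G x t") (auto dest!: stages_sound[OF F] stages_sound[OF G])
qed

lemma stages_comp:
  assumes F: "stages f F" and G: "stages g G"
  shows "stages (\<lambda>n. Option.bind (g n) f)
    (\<lambda>x t. if G x t = 0 then 0 else F (G x t - 1) t)" (is "stages ?h ?T")
  unfolding stages_def
proof (intro conjI allI impI iffI)
  show "computable_nat2 ?T" unfolding computable_nat2_def
    by (intro computable_intros stages_computable[OF F] stages_computable[OF G])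
next
  fix x y t t' assume "?T x t = Suc y" "t \<le> t'"
  then show "?T x t' = Suc y"
    using stages_stable[OF F \<open>t \<le> t'\<close>, of "G x t - 1"] stages_stable[OF G \<open>t \<le> t'\<close>, of x]
    by (auto split: if_splits)
next
  fix x y assume "?h x = Some y"
  then obtain u where u: "g x = Some u" "f u = Some y"
    by (auto simp: bind_eq_Some_conv)
  obtain t t' where "G x t = Suc u" "F u t' = Suc y"
    using stages_complete[OF G u(1)] stages_complete[OF F u(2)] by blast
  then have "G x (max t t') = Suc u" "F u (max t t') = Suc y"
    by (auto intro: stages_mono[OF F] stages_mono[OF G])
  then show "\<exists>t. ?T x t = Suc y" by (intro exI[of _ "max t t'"]) simp
next
  fix x y assume "\<exists>t. ?T x t = Suc y"
  then obtain t where "?T x t = Suc y" by blast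
  then show "?h x = Some y"
    by (cases "G x t") (auto dest!: stages_sound[OF F] stages_sound[OF G])
qed

text \<open>The whole recursion is run at one fixed stage \<open>t\<close>; the value
  \<open>0\<close> propagates as soon as some step has not halted by then.\<close>

primrec stage_rec :: "(nat \<Rightarrow> nat \<Rightarrow> nat) \<Rightarrow> (nat \<Rightarrow> nat \<Rightarrow> nat) \<Rightarrow> nat \<Rightarrow> nat \<Rightarrow> nat \<Rightarrow> nat" where
  "stage_rec F G a t 0 = F a t"
| "stage_rec F G a t (Suc n) = (if stage_rec F G a t n = 0 then 0
     else G (prod_encode (a, prod_encode (n, stage_rec F G a t n - 1))) t)"

lemma stages_prec:
  assumes F: "stages f F" and G: "stages g G"
  shows "stages (\<lambda>n. prim_recursion f g (fst (prod_decode n)) (snd (prod_decode n)))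
    (\<lambda>x t. stage_rec F G (fst (prod_decode x)) t (snd (prod_decode x)))" (is "stages ?h ?T")
proof -
  have mono: "stage_rec F G a t n = Suc y \<Longrightarrow> t \<le> t' \<Longrightarrow> stage_rec F G a t' n = Suc y" for a t t' n y
  proof (induction n arbitrary: y)
    case 0
    then show ?case using stages_mono[OF F _ \<open>t \<le> t'\<close>] by simp
  next
    case (Suc n)
    then show ?case
      using stages_mono[OF G _ \<open>t \<le> t'\<close>] by (cases "stage_rec F G a t n") auto
  qed
  have sound: "stage_rec F G a t n = Suc y \<Longrightarrow> prim_recursion f g a n = Some y" for a t n y
  proof (induction n arbitrary: y)
    case 0
    then show ?case using stages_sound[OF F] by simp
  next
    case (Suc n)
    then show ?case
      by (cases "stage_rec F G a t n") (auto dest!: stages_sound[OF G])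
  qed
  have complete: "prim_recursion f g a n = Some y \<Longrightarrow> \<exists>t. stage_rec F G a t n = Suc y" for a n y
  proof (induction n arbitrary: y)
    case 0
    then show ?case by (simp add: stages_complete[OF F])
  next
    case (Suc n)
    then obtain u where u: "prim_recursion f g a n = Some u" "g (prod_encode (a, prod_encode (n, u))) = Some y"
      by (auto simp: bind_eq_Some_conv)
    obtain t t' where t: "stage_rec F G a t n = Suc u" "G (prod_encode (a, prod_encode (n, u))) t' = Suc y"
      using Suc.IH[OF u(1)] stages_complete[OF G u(2)] by blast
    have "stage_rec F G a (max t t') n = Suc u" "G (prod_encode (a, prod_encode (n, u))) (max t t') = Suc y"
      using mono[OF t(1)] stages_mono[OF G t(2)] by auto
    then show ?case by (intro exI[of _ "max t t'"]) simp
  qed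
  \<comment> \<open>The recursion runs over \<open>n\<close> only, so parameter and stage are packed
    into the single argument \<open>p\<close>.\<close>
  have "computable_nat2 (\<lambda>p n. stage_rec F G (fst (prod_decode p)) (snd (prod_decode p)) n)"
    by (rule computable_nat2_rec[where f = "\<lambda>p. F (fst (prod_decode p)) (snd (prod_decode p))"
          and G = "\<lambda>p n r. if r = 0 then 0 else G (prod_encode (fst (prod_decode p), prod_encode (n, r - 1))) (snd (prod_decode p))"])
      ((intro computable_intros stages_computable[OF F] stages_computable[OF G])?; simp)+
  from computable_nat2_apply[OF this,
      of "\<lambda>q. prod_encode (fst (prod_decode (fst (prod_decode q))), snd (prod_decode q))" "\<lambda>q. snd (prod_decode (fst (prod_decode q)))"]
  have "computable_nat2 ?T" unfolding computable_nat2_def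
    by (simp add: computable_intros)
  then show ?thesis unfolding stages_def using mono sound complete by blast
qed

lemma is_mu_unique: "is_mu f a n \<Longrightarrow> is_mu f a n' \<Longrightarrow> n = n'"
  unfolding is_mu_def by (metis linorder_neqE_nat nat.distinct(1) option.inject)

lemma minimisation_eq_Some_iff: "minimisation f a = Some n \<longleftrightarrow> is_mu f a n"
proof
  show "is_mu f a n" if "minimisation f a = Some n"
    using that unfolding minimisation_def by (auto split: if_splits intro: LeastI)
next
  assume mu: "is_mu f a n"
  then have "(LEAST n. is_mu f a n) = n" by (intro Least_equality) (auto dest: is_mu_unique[OF mu])
  then show "minimisation f a = Some n" unfolding minimisation_def using mu by auto
qed

text \<open>At stage \<open>t\<close> only candidates \<open>n < t\<close> are inspected. Because of
  the halting mark, an observed zero reads \<open>1\<close> and an observed positive value at least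
  \<open>2\<close>. At most one candidate is good, so the sum defining \<open>T\<close> has at most
  one nonzero term, namely \<open>Suc n\<close>.\<close>

lemma stages_mu:
  assumes F: "stages f F"
  shows "\<exists>T. stages (minimisation f) T"
proof -
  define good where "good a t n \<longleftrightarrow> F (prod_encode (a, n)) t = 1 \<and> (\<forall>m<n. 2 \<le> F (prod_encode (a, m)) t)" for a t n
  define T where "T a t = (\<Sum>n<t. if good a t n then Suc n else 0)" for a t
  have good_mono: "good a t n \<Longrightarrow> t \<le> t' \<Longrightarrow> good a t' n" for a t t' n
  proof -
    assume g: "good a t n" and le: "t \<le> t'"
    have "2 \<le> F x t \<Longrightarrow> 2 \<le> F x t'" for x
      using stages_mono[OF F _ le] by (metis Suc_le_D numeral_2_eq_2)
    then show "good a t' n" using g stages_mono[OF F _ le, of _ 0] unfolding good_def by auto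
  qed
  have good_unique: "good a t n \<Longrightarrow> good a t n' \<Longrightarrow> n = n'" for a t n n'
    unfolding good_def by (metis linorder_neqE_nat not_numeral_le_zero numeral_le_one_iff semiring_norm(69))
  have T_iff: "T a t = Suc n \<longleftrightarrow> n < t \<and> good a t n" for a t n
  proof -
    have *: "T a t = Suc n" if "n < t" "good a t n" for n
    proof -
      have "good a t j \<longleftrightarrow> j = n" for j using good_unique that(2) by blast
      then have "T a t = (\<Sum>j<t. if j = n then Suc n else 0)"
        unfolding T_def by (intro sum.cong) auto
      then show ?thesis using that(1) by simp
    qed
    have "\<exists>j<t. good a t j" if "T a t = Suc n"
    proof (rule ccontr)
      assume "\<not> (\<exists>j<t. good a t j)"
      then have "T a t = 0" unfolding T_def by simp
      then show False using that by simp
    qed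
    with * show ?thesis by (metis nat.inject)
  qed
  have good_sound: "is_mu f a n" if "good a t n" for a t n
    unfolding is_mu_def
  proof (intro conjI allI impI)
    show "f (prod_encode (a, n)) = Some 0"
      using that stages_sound[OF F, of _ t 0] unfolding good_def by simp
  next
    fix m assume "m < n"
    then have "2 \<le> F (prod_encode (a, m)) t" using that unfolding good_def by simp
    then have "F (prod_encode (a, m)) t = Suc (Suc (F (prod_encode (a, m)) t - 2))" by simp
    from stages_sound[OF F this] show "\<exists>v. f (prod_encode (a, m)) = Some (Suc v)" by blast
  qed
  have good_complete: "\<exists>t. good a t n" if mu: "is_mu f a n" for a n
  proof -
    have "\<exists>t. m \<le> n \<longrightarrow> F (prod_encode (a, m)) t \<noteq> 0" for m
    proof (cases "m \<le> n")
      case True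
      then obtain v where "f (prod_encode (a, m)) = Some v"
        using mu unfolding is_mu_def by (metis le_neq_implies_less)
      from stages_complete[OF F this] show ?thesis by (metis nat.distinct(1))
    qed simp
    then obtain s where s: "\<And>m. m \<le> n \<Longrightarrow> F (prod_encode (a, m)) (s m) \<noteq> 0" by metis
    \<comment> \<open>The sum dominates every \<open>s m\<close>, so all the computations up to
      \<open>n\<close> have halted by stage \<open>t\<close>.\<close>
    define t where "t = (\<Sum>m\<le>n. s m)"
    have "s m \<le> t" if "m \<le> n" for m unfolding t_def using that by (intro member_le_sum) auto
    then have nz: "\<exists>v. F (prod_encode (a, m)) t = Suc v" if "m \<le> n" for m
      using s[OF that] stages_stable[OF F _ s[OF that]] that by (metis not0_implies_Suc)
    have "F (prod_encode (a, n)) t = 1"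
    proof -
      obtain v where v: "F (prod_encode (a, n)) t = Suc v" using nz by blast
      with stages_sound[OF F v] mu show ?thesis unfolding is_mu_def by simp
    qed
    moreover have "2 \<le> F (prod_encode (a, m)) t" if "m < n" for m
    proof -
      obtain v where v: "F (prod_encode (a, m)) t = Suc v" using nz \<open>m < n\<close> by (meson less_imp_le)
      moreover have "v \<noteq> 0" using stages_sound[OF F v] mu \<open>m < n\<close> unfolding is_mu_def by fastforce
      ultimately show ?thesis by simp
    qed
    ultimately show ?thesis unfolding good_def by blast
  qed
  have "computable_nat2 T" unfolding computable_nat2_def T_def good_def
    by (intro computable_nat_sum computable_intros)
      (unfold computable_nat2_def, intro computable_intros decidable_ball_less stages_computable[OF F])
  moreover have "minimisation f x = Some y \<longleftrightarrow> (\<exists>t. T x t = Suc y)" for x y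
  proof
    assume "minimisation f x = Some y"
    then obtain t where "good x t y" using good_complete minimisation_eq_Some_iff by blast
    \<comment> \<open>The stage must also exceed \<open>y\<close>, as \<open>T\<close> inspects only
      candidates below the stage.\<close>
    then have "good x (max t (Suc y)) y" by (rule good_mono) simp
    then have "T x (max t (Suc y)) = Suc y" unfolding T_iff by simp
    then show "\<exists>t. T x t = Suc y" by blast
  next
    assume "\<exists>t. T x t = Suc y"
    then show "minimisation f x = Some y" unfolding T_iff minimisation_eq_Some_iff using good_sound by blast
  qed
  moreover have "T x t = Suc y \<Longrightarrow> t \<le> t' \<Longrightarrow> T x t' = Suc y" for x y t t'
    unfolding T_iff using good_mono by fastforce
  ultimately have "stages (minimisation f) T" unfolding stages_def by blast
  then show ?thesis by blast
qed

lemma partial_recursive_stages: "partial_recursive h \<Longrightarrow> \<exists>T. stages h T"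
proof (induction rule: partial_recursive.induct)
  case zero
  show ?case using stages_const[OF computable_nat_const] by blast
next
  case succ
  show ?case using stages_const[OF computable_nat_Suc[OF computable_nat_id]] by blast
next
  case left
  show ?case using stages_const[OF computable_nat_fst[OF computable_nat_id]] by blast
next
  case right
  show ?case using stages_const[OF computable_nat_snd[OF computable_nat_id]] by blast
next
  case (pair f g)
  then show ?case using stages_pair by blast
next
  case (comp f g)
  then show ?case using stages_comp by blast
next
  case (prec f g)
  then show ?case using stages_prec by blast
next
  case (mu f)
  then show ?case using stages_mu by blast
qed

subsection \<open>Traps\<close>

text \<open>The \<open>q\<close> heaviest elements carry at least the average share of the weight:
  removing an element of least weight never lowers the average, and this is repeated until
  \<open>q\<close> elements remain.\<close>

lemma heavy_subset:
  fixes w :: "'a \<Rightarrow> nat"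
  assumes "finite V" "q \<le> card V"
  shows "\<exists>B\<subseteq>V. card B = q \<and> q * sum w V \<le> card V * sum w B"
  using assms
proof (induction "card V" arbitrary: V)
  case 0
  then show ?case by auto
next
  case (Suc v)
  show ?case
  proof (cases "q = card V")
    case True
    then show ?thesis by blast
  next
    case False
    have "V \<noteq> {}" using Suc.hyps(2) by auto
    then have "Min (w ` V) \<in> w ` V" using Suc.prems(1) by (intro Min_in) auto
    then obtain x where x: "x \<in> V" "w x = Min (w ` V)" by auto
    then have min: "w x \<le> w y" if "y \<in> V" for y using Suc.prems(1) that by simp
    have cV: "card (V - {x}) = v" using Suc.hyps(2) x(1) Suc.prems(1) by simp
    have "\<exists>B\<subseteq>V - {x}. card B = q \<and> q * sum w (V - {x}) \<le> card (V - {x}) * sum w B"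
      using Suc.hyps(2) Suc.prems False cV by (intro Suc.hyps(1)) auto
    then obtain B where B: "B \<subseteq> V - {x}" "card B = q" "q * sum w (V - {x}) \<le> v * sum w B"
      unfolding cV by blast
    \<comment> \<open>Every element of \<open>B\<close> weighs at least \<open>w x\<close>; this
      extra copy of \<open>sum w B\<close> pays for the removed element when \<open>v\<close>
      becomes \<open>Suc v\<close>.\<close>
    have "q * w x \<le> sum w B"
      using sum_mono[of B "\<lambda>_. w x" w] B(1,2) min by auto
    moreover have "sum w V = w x + sum w (V - {x})"
      using sum.remove[OF Suc.prems(1) x(1)] .
    moreover have "card V = Suc v" using Suc.hyps(2) by simp
    ultimately have "q * sum w V \<le> card V * sum w B"
      using B(3) by (simp add: algebra_simps)
    then show ?thesis using B by blast
  qed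
qed

text \<open>\<open>heavy_subset\<close> is applied with the weight of a value equal to the size of
  its fibre under \<open>g\<close>; the fibres partition \<open>Y\<close>.\<close>

lemma popular_values:
  assumes "finite Y" "finite V" "q \<le> card V" "g ` Y \<subseteq> V"
  shows "\<exists>B\<subseteq>V. card B = q \<and> q * card Y \<le> card V * card {z \<in> Y. g z \<in> B}"
proof -
  have fib: "card {z \<in> Y. g z \<in> B} = (\<Sum>b\<in>B. card {z \<in> Y. g z = b})" if "B \<subseteq> V" for B
  proof -
    have "finite B" using that assms(2) finite_subset by blast
    then have "card (\<Union>b\<in>B. {z \<in> Y. g z = b}) = (\<Sum>b\<in>B. card {z \<in> Y. g z = b})"
      using assms(1) by (intro card_UN_disjoint) auto
    moreover have "(\<Union>b\<in>B. {z \<in> Y. g z = b}) = {z \<in> Y. g z \<in> B}" by blast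
    ultimately show ?thesis by simp
  qed
  have Y: "card Y = (\<Sum>b\<in>V. card {z \<in> Y. g z = b})"
  proof -
    have "{z \<in> Y. g z \<in> V} = Y" using assms(4) by blast
    then show ?thesis using fib[of V] by simp
  qed
  obtain B where "B \<subseteq> V" "card B = q"
    "q * (\<Sum>b\<in>V. card {z \<in> Y. g z = b}) \<le> card V * (\<Sum>b\<in>B. card {z \<in> Y. g z = b})"
    using heavy_subset[OF assms(2,3), of "\<lambda>b. card {z \<in> Y. g z = b}"] by blast
  then show ?thesis using fib[of B] Y by auto
qed

text \<open>Definedness is demanded for all indices in \<open>S\<close>, so that being caught can
  later be confirmed at a finite stage; indices outside \<open>S\<close> are unrestricted.\<close>

definition caught :: "('i \<Rightarrow> 'a \<Rightarrow> 'b option) \<Rightarrow> 'a set \<Rightarrow> 'i set \<Rightarrow> 'b set \<Rightarrow> 'a set" where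
  "caught g Z S B = {z \<in> Z. \<forall>i\<in>S. \<exists>b\<in>B. g i z = Some b}"

text \<open>
  Each index added to \<open>S\<close> may cost \<open>q\<close> further elements of \<open>B\<close> and a factor \<open>q / u\<close> of the caught
  inputs; \<open>u\<close> will be \<open>2 * k\<close> times the number of possible outputs.
\<close>

definition trap :: "('i \<Rightarrow> 'a \<Rightarrow> 'b option) \<Rightarrow> 'a set \<Rightarrow> nat \<Rightarrow> nat \<Rightarrow> 'i set \<Rightarrow> 'b set \<Rightarrow> bool" where
  "trap g Z q u S B \<longleftrightarrow> finite B \<and> card B \<le> card S * q \<and>
     card Z * q ^ card S \<le> card (caught g Z S B) * u ^ card S"

text \<open>A fraction of at least \<open>1 / c\<close> of the caught inputs has \<open>g i\<close>
  defined, and the \<open>q\<close> most popular values of \<open>g i\<close> on these keep a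
  further fraction \<open>q / card V\<close>. Together this is the factor allowed for one new
  index.\<close>

lemma trap_extend:
  assumes Z: "finite Z" and V: "finite V" and q: "q \<le> card V"
    and gV: "\<And>z b. z \<in> Z \<Longrightarrow> g i z = Some b \<Longrightarrow> b \<in> V"
    and S: "finite S" "i \<notin> S" and trap: "trap g Z q (c * card V) S B"
    and many: "card (caught g Z S B) \<le> c * card {z \<in> caught g Z S B. g i z \<noteq> None}"
  shows "\<exists>B'. trap g Z q (c * card V) (insert i S) B'"
proof -
  define Y where "Y = {z \<in> caught g Z S B. g i z \<noteq> None}"
  have YZ: "Y \<subseteq> Z" unfolding Y_def caught_def by blast
  have finY: "finite Y" using YZ Z finite_subset by blast
  have "(\<lambda>z. the (g i z)) ` Y \<subseteq> V" using gV YZ unfolding Y_def by auto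
  then obtain B' where B': "B' \<subseteq> V" "card B' = q"
    "q * card Y \<le> card V * card {z \<in> Y. the (g i z) \<in> B'}"
    using popular_values[OF finY V q] by blast
  have finB': "finite B'" using B'(1) V finite_subset by blast
  have sub: "{z \<in> Y. the (g i z) \<in> B'} \<subseteq> caught g Z (insert i S) (B \<union> B')"
    unfolding Y_def caught_def by auto
  have "finite (caught g Z (insert i S) (B \<union> B'))" using Z unfolding caught_def by simp
  from card_mono[OF this sub]
  have c: "q * card Y \<le> card V * card (caught g Z (insert i S) (B \<union> B'))"
    using B'(3) by (meson le_trans mult_le_mono2)
  have "card Z * q ^ Suc (card S) = (card Z * q ^ card S) * q" by simp
  also have "\<dots> \<le> (card (caught g Z S B) * (c * card V) ^ card S) * q"
    using trap unfolding trap_def by (intro mult_right_mono) auto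
  also have "\<dots> \<le> (c * card Y * (c * card V) ^ card S) * q"
    using many unfolding Y_def by (intro mult_right_mono) auto
  also have "\<dots> = (q * card Y) * (c * (c * card V) ^ card S)" by (simp add: algebra_simps)
  also have "\<dots> \<le> (card V * card (caught g Z (insert i S) (B \<union> B'))) * (c * (c * card V) ^ card S)"
    using c by (rule mult_right_mono) simp
  also have "\<dots> = card (caught g Z (insert i S) (B \<union> B')) * (c * card V) ^ Suc (card S)"
    by (simp add: algebra_simps)
  finally have "card Z * q ^ Suc (card S) \<le> \<dots>" .
  moreover have "card (B \<union> B') \<le> card S * q + q"
    using card_Un_le[of B B'] B'(2) trap unfolding trap_def by linarith
  ultimately have "trap g Z q (c * card V) (insert i S) (B \<union> B')"
    using S finB' trap unfolding trap_def by (simp add: add.commute)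
  then show ?thesis by blast
qed

text \<open>\<open>S\<close> is a largest index set that supports a trap. For any trap over it, each
  further index is defined on at most a fraction \<open>1 / (2 * k)\<close> of the caught inputs,
  since otherwise \<open>S\<close> could be extended. Hence at least half of the caught inputs have
  all their defined outputs in \<open>B\<close>. The bound covers every trap over \<open>S\<close>
  because a search may find a different one.\<close>

lemma maximal_trap:
  assumes Z: "finite Z" and V: "finite V" and q: "q \<le> card V"
    and K: "finite K" "card K = k" "0 < k"
    and gV: "\<And>i z b. i \<in> K \<Longrightarrow> z \<in> Z \<Longrightarrow> g i z = Some b \<Longrightarrow> b \<in> V"
  shows "\<exists>S\<subseteq>K. (\<exists>B. trap g Z q (2 * k * card V) S B) \<and>
    (\<forall>B. trap g Z q (2 * k * card V) S B \<longrightarrow>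
       card Z * q ^ k \<le> 2 * card {z \<in> Z. \<forall>i\<in>K. \<forall>b. g i z = Some b \<longrightarrow> b \<in> B} * (2 * k * card V) ^ k)"
proof -
  let ?u = "2 * k * card V"
  let ?Q = "\<lambda>S. S \<subseteq> K \<and> (\<exists>B. trap g Z q ?u S B)"
  have "trap g Z q ?u {} {}" unfolding trap_def caught_def by simp
  then have "?Q {}" by blast
  moreover have "\<forall>S. ?Q S \<longrightarrow> card S < Suc k" using K card_mono less_Suc_eq_le by blast
  ultimately have "\<exists>S. ?Q S \<and> (\<forall>S'. ?Q S' \<longrightarrow> card S' \<le> card S)"
    by (rule Lattices_Big.ex_has_greatest_nat)
  then obtain S where S: "?Q S" and max': "\<forall>S'. ?Q S' \<longrightarrow> card S' \<le> card S" by auto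
  from max' have max: "\<And>S'. ?Q S' \<Longrightarrow> card S' \<le> card S" by blast
  have finS: "finite S" using S K(1) finite_subset by blast
  have sk: "card S \<le> k" using S K card_mono by blast
  have "card Z * q ^ k \<le> 2 * card {z \<in> Z. \<forall>i\<in>K. \<forall>b. g i z = Some b \<longrightarrow> b \<in> B} * ?u ^ k"
    if trap: "trap g Z q ?u S B" for B
  proof -
    define X where "X = caught g Z S B"
    define Y where "Y i = {z \<in> X. g i z \<noteq> None}" for i
    define G where "G = {z \<in> Z. \<forall>i\<in>K. \<forall>b. g i z = Some b \<longrightarrow> b \<in> B}"
    have finX: "finite X" using Z unfolding X_def caught_def by simp
    have Yi: "2 * k * card (Y i) \<le> card X" if i: "i \<in> K - S" for i
    proof (rule ccontr)
      assume "\<not> ?thesis"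
      then have "card X \<le> 2 * k * card (Y i)" by simp
      then have "\<exists>B'. trap g Z q ?u (insert i S) B'"
        using i gV trap unfolding X_def Y_def
        by (intro trap_extend[OF Z V q _ finS, of g i "2 * k" B]) auto
      then have "?Q (insert i S)" using i S by blast
      from max[OF this] show False using i finS by simp
    qed
    have "X \<subseteq> G \<union> (\<Union>i\<in>K - S. Y i)"
    proof
      fix z assume z: "z \<in> X"
      show "z \<in> G \<union> (\<Union>i\<in>K - S. Y i)"
      proof (cases "\<exists>i\<in>K - S. g i z \<noteq> None")
        case True
        then show ?thesis using z unfolding Y_def by blast
      next
        case False
        have "b \<in> B" if "i \<in> K" "g i z = Some b" for i b
        proof -
          have "i \<in> S" using False that by force
          then obtain b' where "b' \<in> B" "g i z = Some b'" using z unfolding X_def caught_def by blast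
          then show ?thesis using that by simp
        qed
        then show ?thesis using z unfolding G_def X_def caught_def by blast
      qed
    qed
    moreover have "finite (G \<union> (\<Union>i\<in>K - S. Y i))" using Z finX K(1) unfolding G_def Y_def by simp
    ultimately have "card X \<le> card (G \<union> (\<Union>i\<in>K - S. Y i))"
      by (rule card_mono[rotated])
    also have "\<dots> \<le> card G + (\<Sum>i\<in>K - S. card (Y i))"
      using card_Un_le[of G "\<Union>i\<in>K - S. Y i"] card_UN_le[of "K - S" Y] K(1) by simp
    finally have "2 * k * card X \<le> 2 * k * card G + (\<Sum>i\<in>K - S. 2 * k * card (Y i))"
      by (metis add_mult_distrib2 mult_le_mono2 sum_distrib_left)
    also have "(\<Sum>i\<in>K - S. 2 * k * card (Y i)) \<le> (\<Sum>i\<in>K - S. card X)"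
      using Yi by (rule sum_mono)
    also have "\<dots> \<le> k * card X" using card_mono[of K "K - S"] K by simp
    finally have "k * card X \<le> k * (2 * card G)" by simp
    then have XG: "card X \<le> 2 * card G" using K(3) by simp
    have split: "a ^ card S * a ^ (k - card S) = a ^ k" for a :: nat
      using sk by (simp add: power_add[symmetric])
    \<comment> \<open>Padding with \<open>q \<le> u\<close> for the missing indices turns the
      exponent \<open>card S\<close> into \<open>k\<close>, uniformly in \<open>S\<close>.\<close>
    have "card Z * q ^ k = card Z * q ^ card S * q ^ (k - card S)"
      by (simp only: mult.assoc split)
    also have "\<dots> \<le> card X * ?u ^ card S * ?u ^ (k - card S)"
    proof (rule mult_le_mono)
      show "card Z * q ^ card S \<le> card X * ?u ^ card S"
        using trap unfolding trap_def X_def by simp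
      have "q \<le> ?u" using q K(3) by (metis le_trans mult_le_mono1 nat_mult_1 One_nat_def Suc_leI nat_0_less_mult_iff zero_less_numeral)
      then show "q ^ (k - card S) \<le> ?u ^ (k - card S)" by (rule power_mono) simp
    qed
    also have "\<dots> = card X * ?u ^ k"
      by (simp only: split mult.assoc[of "card X" "?u ^ card S"])
    also have "\<dots> \<le> 2 * card G * ?u ^ k" using XG by (rule mult_le_mono1)
    finally show ?thesis unfolding G_def .
  qed
  then show ?thesis using S by blast
qed

section \<open>Listing a finite set of numbers by the digits of one number\<close>

lemma digits_exist:
  fixes Q :: nat
  assumes "\<And>j. j < J \<Longrightarrow> b j < Q"
  shows "\<exists>y. \<forall>j<J. y div Q ^ j mod Q = b j"
  using assms
proof (induction J arbitrary: b)
  case (Suc J)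
  have "\<exists>y. \<forall>j<J. y div Q ^ j mod Q = b (Suc j)" using Suc.prems by (intro Suc.IH) simp
  then obtain y where y: "\<And>j. j < J \<Longrightarrow> y div Q ^ j mod Q = b (Suc j)" by blast
  have b0: "b 0 < Q" using Suc.prems by simp
  have "(b 0 + Q * y) div Q ^ j mod Q = b j" if "j < Suc J" for j
  proof (cases j)
    case 0
    then show ?thesis using b0 by simp
  next
    case (Suc i)
    have "(b 0 + Q * y) div Q ^ Suc i = y div Q ^ i"
      using b0 by (simp add: div_mult2_eq)
    then show ?thesis using y that Suc by simp
  qed
  then show ?case by blast
qed simp

text \<open>This lets a search over numbers range over all candidate sets. Surplus digits repeat an
  element of \<open>B\<close>, which requires \<open>B\<close> to be nonempty; the empty set is
  covered trivially.\<close>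

lemma digits_cover:
  fixes Q :: nat
  assumes "finite B" "card B \<le> J" "B \<subseteq> {..<Q}"
  shows "\<exists>y. B \<subseteq> (\<lambda>j. y div Q ^ j mod Q) ` {..<J}"
proof (cases "B = {}")
  case False
  obtain b where b: "bij_betw b {..<card B} B"
    using ex_bij_betw_nat_finite[OF assms(1)] atLeast0LessThan by metis
  obtain x where x: "x \<in> B" using False by blast
  have "(if j < card B then b j else x) < Q" for j
    using x assms(3) bij_betwE[OF b] by auto
  then obtain y where y: "\<And>j. j < J \<Longrightarrow> y div Q ^ j mod Q = (if j < card B then b j else x)"
    using digits_exist[of J "\<lambda>j. if j < card B then b j else x" Q] by blast
  have "B = b ` {..<card B}" using b by (simp add: bij_betw_def)
  also have "\<dots> = (\<lambda>j. y div Q ^ j mod Q) ` {..<card B}" using y assms(2) by (intro image_cong) auto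
  also have "\<dots> \<subseteq> (\<lambda>j. y div Q ^ j mod Q) ` {..<J}" using assms(2) by (intro image_mono) auto
  finally show ?thesis by blast
qed simp

subsection \<open>Plain complexity\<close>

text \<open>The codes of the strings of length \<open>m\<close> fill the interval from
  \<open>2 ^ m - 1\<close> to \<open>2 ^ Suc m - 2\<close>. This is why inputs of length
  \<open>m\<close> appear below as \<open>2 ^ m - 1 + z\<close> with
  \<open>z < 2 ^ m\<close>.\<close>

lemma str_code_bounds: "2 ^ length s \<le> Suc (str_code s) \<and> Suc (str_code s) < 2 ^ Suc (length s)"
  by (induction s) auto

lemma length_le_if_str_code_less:
  assumes "Suc (str_code s) < 2 ^ Suc L" shows "length s \<le> L"
proof -
  have "(2::nat) ^ length s < 2 ^ Suc L" using assms str_code_bounds[of s] by linarith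
  then have "length s < Suc L" by (rule power_less_imp_less_exp[rotated]) simp
  then show ?thesis by simp
qed

lemma length_eq_if_str_code:
  assumes "str_code s = 2 ^ m - 1 + z" "z < 2 ^ m" shows "length s = m"
proof -
  have "Suc (str_code s) = 2 ^ m + z" using assms(1) by simp
  then have "Suc (str_code s) < 2 ^ Suc m" "2 ^ m \<le> Suc (str_code s)" using assms(2) by auto
  then have "length s \<le> m" "(2::nat) ^ m < 2 ^ Suc (length s)"
    using length_le_if_str_code_less str_code_bounds[of s] by (blast, linarith)
  moreover from this(2) have "m < Suc (length s)" by (rule power_less_imp_less_exp[rotated]) simp
  ultimately show ?thesis by simp
qed

lemma str_code_surj: obtains s where "str_code s = y"
  using bij_str_code by (metis bij_pointE)

lemma str_code_inj: "str_code s = str_code t \<longleftrightarrow> s = t"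
  using bij_str_code by (meson bij_def injD)

lemma finite_length_less: "finite {p :: bool list. length p < l}"
  and card_length_less: "card {p :: bool list. length p < l} < 2 ^ l"
proof -
  have sub: "str_code ` {p. length p < l} \<subseteq> {..<2 ^ l - 1}"
  proof (rule image_subsetI)
    fix p :: "bool list" assume "p \<in> {p. length p < l}"
    then have "length p < l" by simp
    then have "(2::nat) ^ Suc (length p) \<le> 2 ^ l" by (intro power_increasing) auto
    then have "Suc (str_code p) < 2 ^ l" using str_code_bounds[of p] by linarith
    then show "str_code p \<in> {..<2 ^ l - 1}" by (simp add: less_diff_conv)
  qed
  have inj: "inj_on str_code A" for A by (simp add: inj_on_def str_code_inj)
  show "finite {p :: bool list. length p < l}"
    using finite_imageD[OF finite_subset[OF sub] inj] by simp
  have "card {p :: bool list. length p < l} \<le> 2 ^ l - 1"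
    using card_mono[OF _ sub] card_image[OF inj] by simp
  also have "\<dots> < 2 ^ l" by simp
  finally show "card {p :: bool list. length p < l} < 2 ^ l" .
qed

lemma plain_complexity_le: "U p = Some s \<Longrightarrow> plain_complexity U s \<le> length p"
  unfolding plain_complexity_def by (rule Least_le) blast

text \<open>Conjugating \<open>h\<close> with the bijection \<open>str_code\<close> gives a machine
  on strings, which \<open>U\<close> simulates up to an additive constant.\<close>

lemma optimal_machine_complexity_le:
  assumes U: "optimal_machine U" and h: "partial_recursive h"
  shows "\<exists>c. \<forall>p s. h (str_code p) = Some (str_code s) \<longrightarrow> plain_complexity U s \<le> length p + c"
proof -
  define M where "M p = map_option (inv str_code) (h (str_code p))" for p
  have inv: "str_code (inv str_code y) = y" for y
    using bij_str_code by (simp add: bij_is_surj surj_f_inv_f)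
  have inv': "inv str_code (str_code s) = s" for s
    using bij_str_code by (simp add: bij_is_inj inv_f_f)
  have "partial_computable M"
    unfolding partial_computable_def
    by (rule exI[of _ h]) (simp add: h M_def option.map_comp comp_def inv option.map_ident)
  then obtain c where c: "\<forall>p s. M p = Some s \<longrightarrow> (\<exists>q. U q = Some s \<and> length q \<le> length p + c)"
    using U unfolding optimal_machine_def by blast
  have "plain_complexity U s \<le> length p + c" if "h (str_code p) = Some (str_code s)" for p s
  proof -
    have "M p = Some s" using that by (simp add: M_def inv')
    then obtain q where "U q = Some s" "length q \<le> length p + c" using c by blast
    then show ?thesis using plain_complexity_le[of U q s] by linarith
  qed
  then show ?thesis by blast
qed

text \<open>Optimality against the identity machine. It guarantees that the minimum defining
  \<open>plain_complexity\<close> ranges over a nonempty set.\<close>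

lemma optimal_machine_surj:
  assumes "optimal_machine U" shows "\<exists>p. U p = Some s"
proof -
  have "partial_recursive (\<lambda>x. Some x)" using computable_nat_id unfolding computable_nat_def .
  then have "partial_computable Some" unfolding partial_computable_def by (intro exI) auto
  then show ?thesis using assms unfolding optimal_machine_def by blast
qed

lemma plain_complexity_attained:
  assumes "optimal_machine U" shows "\<exists>p. U p = Some s \<and> length p = plain_complexity U s"
  unfolding plain_complexity_def
  by (rule LeastI_ex) (use optimal_machine_surj[OF assms] in blast)

lemma finite_complexity_less:
  assumes "optimal_machine U" shows "finite {s. plain_complexity U s < l}"
    and "card {s. plain_complexity U s < l} < 2 ^ l"
proof -
  have sub: "{s. plain_complexity U s < l} \<subseteq> (\<lambda>p. the (U p)) ` {p. length p < l}"
  proof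
    fix s assume "s \<in> {s. plain_complexity U s < l}"
    moreover obtain p where "U p = Some s" "length p = plain_complexity U s"
      using plain_complexity_attained[OF assms] by blast
    ultimately show "s \<in> (\<lambda>p. the (U p)) ` {p. length p < l}"
      by (intro image_eqI[of _ _ p]) auto
  qed
  show "finite {s. plain_complexity U s < l}"
    using finite_subset[OF sub] finite_length_less by blast
  have "card {s. plain_complexity U s < l} \<le> card {p :: bool list. length p < l}"
    using surj_card_le[OF finite_length_less sub] .
  also have "\<dots> < 2 ^ l" by (rule card_length_less)
  finally show "card {s. plain_complexity U s < l} < 2 ^ l" .
qed

text \<open>
  The program \<open>2 ^ e * (2 * x + 1)\<close> carries the parameter \<open>e\<close> in unary. This is affordable
  because only output lengths \<open>n = 4 ^ e\<close> are considered, so that \<open>e\<close> is logarithmic in \<open>n\<close>.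
\<close>

lemma complexity_le_of_parameter:
  assumes U: "optimal_machine U" and h: "partial_recursive h"
  shows "\<exists>c. \<forall>e l x s. x < 2 ^ l \<longrightarrow> h (2 ^ e * (2 * x + 1)) = Some (str_code s) \<longrightarrow>
    plain_complexity U s \<le> l + e + c"
proof -
  obtain c where c: "\<And>p s. h (str_code p) = Some (str_code s) \<Longrightarrow> plain_complexity U s \<le> length p + c"
    using optimal_machine_complexity_le[OF U h] by blast
  have "plain_complexity U s \<le> l + e + Suc c"
    if x: "x < 2 ^ l" and hs: "h (2 ^ e * (2 * x + 1)) = Some (str_code s)" for e l x s
  proof -
    obtain p where p: "str_code p = 2 ^ e * (2 * x + 1)" by (rule str_code_surj)
    have "2 * x + 2 \<le> 2 ^ Suc l" using x by simp
    then have "(2::nat) ^ e * (2 * x + 2) \<le> 2 ^ e * 2 ^ Suc l" by (rule mult_le_mono2)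
    moreover have "Suc (2 ^ e * (2 * x + 1)) \<le> 2 ^ e * (2 * x + 2)" by (simp add: algebra_simps Suc_le_eq)
    ultimately have "Suc (str_code p) \<le> 2 ^ (e + Suc l)" unfolding p power_add by linarith
    also have "\<dots> < 2 ^ Suc (e + Suc l)" by simp
    finally have "length p \<le> e + Suc l" by (rule length_le_if_str_code_less)
    then show ?thesis using c[of p s] hs p by simp
  qed
  then show ?thesis by blast
qed

text \<open>Since \<open>P\<close> is decidable, the function to be minimised is total, and no
  candidate below the least witness can block the search.\<close>

lemma partial_recursive_Least_search:
  assumes P: "decidable (\<lambda>p. P (fst (prod_decode p)) (snd (prod_decode p)))" and G: "computable_nat2 G"
  shows "\<exists>h. partial_recursive h \<and> (\<forall>a. (\<exists>w. P a w) \<longrightarrow> h a = Some (G a (LEAST w. P a w)))"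
proof -
  define F where "F p = Some (of_bool (\<not> P (fst (prod_decode p)) (snd (prod_decode p))) :: nat)" for p
  have F: "partial_recursive F"
    using decidable_not[OF P] unfolding F_def decidable_def computable_nat_def .
  have id: "partial_recursive (\<lambda>a. Some a)"
    using computable_nat_id unfolding computable_nat_def .
  have G': "partial_recursive (\<lambda>p. Some (G (fst (prod_decode p)) (snd (prod_decode p))))"
    using G unfolding computable_nat2_def computable_nat_def .
  define h where "h a = Option.bind (Option.bind (Some a) (\<lambda>x. Option.bind (minimisation F a)
      (\<lambda>y. Some (prod_encode (x, y))))) (\<lambda>p. Some (G (fst (prod_decode p)) (snd (prod_decode p))))" for a
  have "partial_recursive h"
    unfolding h_def
    by (rule partial_recursive.comp[OF G' partial_recursive.pair[OF id partial_recursive.mu[OF F]]])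
  moreover have "h a = Some (G a (LEAST w. P a w))" if ex: "\<exists>w. P a w" for a
  proof -
    have "is_mu F a (LEAST w. P a w)"
      unfolding is_mu_def
    proof (intro conjI allI impI)
      show "F (prod_encode (a, LEAST w. P a w)) = Some 0"
        using LeastI_ex[OF ex] by (simp add: F_def)
    next
      fix m assume "m < (LEAST w. P a w)"
      from not_less_Least[OF this] show "\<exists>v. F (prod_encode (a, m)) = Some (Suc v)"
        by (simp add: F_def)
    qed
    then have "minimisation F a = Some (LEAST w. P a w)" by (simp add: minimisation_eq_Some_iff)
    then show ?thesis by (simp add: h_def)
  qed
  ultimately show ?thesis by blast
qed

section \<open>Effective search for traps\<close>

definition digit :: "nat \<Rightarrow> nat \<Rightarrow> nat \<Rightarrow> nat" where
  "digit Q y j = y div Q ^ j mod Q"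

lemma computable_nat_digit:
  "computable_nat Q \<Longrightarrow> computable_nat y \<Longrightarrow> computable_nat j \<Longrightarrow> computable_nat (\<lambda>x. digit (Q x) (y x) (j x))"
  unfolding digit_def by (intro computable_nat_mod computable_nat_div computable_nat_power)

text \<open>
  The number \<open>w\<close> codes a pair \<open>(y, t)\<close>: the base-\<open>2 ^ (n + 1)\<close> digits of \<open>y\<close> list a trap, where
  \<open>n = 4 ^ e\<close>, and \<open>t\<close> is a stage by which sufficiently many inputs have been caught.
\<close>

definition trap_code :: "('i \<Rightarrow> nat \<Rightarrow> nat \<Rightarrow> nat) \<Rightarrow> (nat \<Rightarrow> nat) \<Rightarrow> nat \<Rightarrow> 'i set \<Rightarrow> nat \<Rightarrow> nat \<Rightarrow> nat \<Rightarrow> bool" where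
  "trap_code T f k S e l w \<longleftrightarrow>
     2 ^ f (4 ^ e) * (2 ^ l div k) ^ card S \<le>
     (\<Sum>z<2 ^ f (4 ^ e). of_bool (\<forall>i\<in>S. \<exists>j<card S * (2 ^ l div k).
        T i (2 ^ f (4 ^ e) - 1 + z) (snd (prod_decode w)) =
          Suc (digit (2 ^ Suc (4 ^ e)) (fst (prod_decode w)) j))) * (2 * k * 2 ^ (4 ^ e)) ^ card S"

text \<open>All quantifiers and sums in \<open>trap_code\<close> are bounded, and halting is only
  tested up to the stage coded in \<open>w\<close>.\<close>

lemma decidable_trap_code:
  assumes T: "\<And>i. i \<in> S \<Longrightarrow> computable_nat2 (T i)" and f: "computable_nat f" and S: "finite S"
    and E: "computable_nat E" and L: "computable_nat L" and W: "computable_nat W"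
  shows "decidable (\<lambda>x. trap_code T f k S (E x) (L x) (W x))"
proof -
  note f' = computable_nat_comp[OF f] and E' = computable_nat_comp[OF E]
    and L' = computable_nat_comp[OF L] and W' = computable_nat_comp[OF W]
  show ?thesis unfolding trap_code_def
    apply (intro decidable_le computable_nat_mult computable_nat_power computable_nat_const
        computable_nat_div computable_nat_sum f' E L W)
    apply (unfold computable_nat2_def)
    apply (intro computable_nat_of_bool decidable_Ball_finite S decidable_bex_less decidable_eq
        computable_nat2_apply[OF T] computable_nat_digit computable_intros computable_nat_div
        f' E' L' W')
    apply assumption+
    done
qed

text \<open>A value seen at the coded stage is a genuine output, so the inputs counted by the code
  are among the caught ones. The number of digits bounds the size of the trap.\<close>

lemma trap_code_sound:
  assumes T: "\<And>i. i \<in> S \<Longrightarrow> stages (h i) (T i)" and code: "trap_code T f k S e l w"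
  shows "trap (\<lambda>i z. h i (2 ^ f (4 ^ e) - 1 + z)) {..<2 ^ f (4 ^ e)} (2 ^ l div k) (2 * k * 2 ^ (4 ^ e)) S
    (digit (2 ^ Suc (4 ^ e)) (fst (prod_decode w)) ` {..<card S * (2 ^ l div k)})"
    (is "trap ?g ?Z ?q ?u S ?B")
proof -
  let ?P = "\<lambda>z. \<forall>i\<in>S. \<exists>j<card S * (2 ^ l div k).
        T i (2 ^ f (4 ^ e) - 1 + z) (snd (prod_decode w)) =
          Suc (digit (2 ^ Suc (4 ^ e)) (fst (prod_decode w)) j)"
  have "{z. z < 2 ^ f (4 ^ e) \<and> ?P z} \<subseteq> caught ?g ?Z S ?B"
  proof
    fix z assume z: "z \<in> {z. z < 2 ^ f (4 ^ e) \<and> ?P z}"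
    have "\<exists>b\<in>?B. ?g i z = Some b" if "i \<in> S" for i
    proof -
      have "\<exists>j<card S * (2 ^ l div k).
        T i (2 ^ f (4 ^ e) - 1 + z) (snd (prod_decode w)) =
          Suc (digit (2 ^ Suc (4 ^ e)) (fst (prod_decode w)) j)" using z that by blast
      then obtain j where "j < card S * (2 ^ l div k)"
        "T i (2 ^ f (4 ^ e) - 1 + z) (snd (prod_decode w)) =
          Suc (digit (2 ^ Suc (4 ^ e)) (fst (prod_decode w)) j)" by blast
      with stages_sound[OF T[OF that] this(2)] show ?thesis by blast
    qed
    then show "z \<in> caught ?g ?Z S ?B" using z unfolding caught_def by blast
  qed
  moreover have "finite (caught ?g ?Z S ?B)" unfolding caught_def by simp
  ultimately have le: "card {z. z < 2 ^ f (4 ^ e) \<and> ?P z} \<le> card (caught ?g ?Z S ?B)"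
    by (intro card_mono)
  have "card ?Z * ?q ^ card S \<le> card {z. z < 2 ^ f (4 ^ e) \<and> ?P z} * ?u ^ card S"
    using code unfolding trap_code_def card_lessThan_sum card_lessThan .
  also have "\<dots> \<le> card (caught ?g ?Z S ?B) * ?u ^ card S"
    using le by (rule mult_le_mono1)
  finally have "card ?Z * ?q ^ card S \<le> card (caught ?g ?Z S ?B) * ?u ^ card S" .
  moreover have "card ?B \<le> card S * ?q" using card_image_le[of "{..<card S * ?q}"] by (metis card_lessThan finite_lessThan)
  ultimately show ?thesis unfolding trap_def by blast
qed

text \<open>Only finitely many indices and inputs are involved, so a single stage \<open>t\<close>,
  the sum of all halting stages, confirms every caught input.\<close>

lemma trap_code_complete:
  assumes T: "\<And>i. i \<in> S \<Longrightarrow> stages (h i) (T i)" and S: "finite S"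
    and bound: "\<And>i z b. i \<in> S \<Longrightarrow> z < 2 ^ f (4 ^ e) \<Longrightarrow> h i (2 ^ f (4 ^ e) - 1 + z) = Some b \<Longrightarrow> b < 2 ^ Suc (4 ^ e)"
    and trap: "trap (\<lambda>i z. h i (2 ^ f (4 ^ e) - 1 + z)) {..<2 ^ f (4 ^ e)} (2 ^ l div k) (2 * k * 2 ^ (4 ^ e)) S B"
    (is "trap ?g ?Z ?q ?u S B")
  shows "\<exists>w. trap_code T f k S e l w"
proof -
  let ?Q = "2 ^ Suc (4 ^ e) :: nat"
  have "finite B" "card B \<le> card S * ?q" using trap unfolding trap_def by auto
  \<comment> \<open>Elements of \<open>B\<close> from \<open>?Q\<close> on are never outputs, and
    the remaining ones fit into base-\<open>?Q\<close> digits.\<close>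
  then have "finite (B \<inter> {..<?Q})" "card (B \<inter> {..<?Q}) \<le> card S * ?q"
    using card_mono[of B "B \<inter> {..<?Q}"] by auto
  from digits_cover[OF this Int_lower2]
  obtain y where y: "B \<inter> {..<?Q} \<subseteq> digit ?Q y ` {..<card S * ?q}"
    unfolding digit_def by blast
  have "\<exists>t. \<forall>b. i \<in> S \<longrightarrow> h i (2 ^ f (4 ^ e) - 1 + z) = Some b \<longrightarrow> T i (2 ^ f (4 ^ e) - 1 + z) t = Suc b" for i z
    using stages_complete[OF T] by (metis option.inject)
  then obtain \<tau> where \<tau>: "\<And>i z b. i \<in> S \<Longrightarrow> h i (2 ^ f (4 ^ e) - 1 + z) = Some b \<Longrightarrow> T i (2 ^ f (4 ^ e) - 1 + z) (\<tau> i z) = Suc b"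
    by metis
  define t where "t = (\<Sum>i\<in>S. \<Sum>z<2 ^ f (4 ^ e). \<tau> i z)"
  have le: "\<tau> i z \<le> t" if "i \<in> S" "z < 2 ^ f (4 ^ e)" for i z
  proof -
    have "\<tau> i z \<le> (\<Sum>z<2 ^ f (4 ^ e). \<tau> i z)" using that(2) by (intro member_le_sum) auto
    also have "\<dots> \<le> t" unfolding t_def using that(1) S by (intro member_le_sum[where f = "\<lambda>i. \<Sum>z<2 ^ f (4 ^ e). \<tau> i z"]) auto
    finally show ?thesis .
  qed
  let ?P = "\<lambda>z. \<forall>i\<in>S. \<exists>j<card S * (2 ^ l div k). T i (2 ^ f (4 ^ e) - 1 + z) t = Suc (digit ?Q y j)"
  have "caught ?g ?Z S B \<subseteq> {z. z < 2 ^ f (4 ^ e) \<and> ?P z}"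
  proof
    fix z assume z: "z \<in> caught ?g ?Z S B"
    then have z': "z < 2 ^ f (4 ^ e)" unfolding caught_def by simp
    have "\<exists>j<card S * (2 ^ l div k). T i (2 ^ f (4 ^ e) - 1 + z) t = Suc (digit ?Q y j)" if i: "i \<in> S" for i
    proof -
      obtain b where b: "b \<in> B" "h i (2 ^ f (4 ^ e) - 1 + z) = Some b" using z i unfolding caught_def by blast
      then have "b \<in> B \<inter> {..<?Q}" using bound[OF i z'] by blast
      then obtain j where j: "j < card S * ?q" "b = digit ?Q y j" using y by blast
      moreover have "T i (2 ^ f (4 ^ e) - 1 + z) t = Suc b"
        using stages_mono[OF T[OF i] \<tau>[OF i b(2)] le[OF i z']] .
      ultimately show ?thesis by blast
    qed
    then show "z \<in> {z. z < 2 ^ f (4 ^ e) \<and> ?P z}" using z' by blast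
  qed
  then have "card (caught ?g ?Z S B) \<le> card {z. z < 2 ^ f (4 ^ e) \<and> ?P z}"
    by (intro card_mono) auto
  then have "card (caught ?g ?Z S B) * ?u ^ card S \<le> card {z. z < 2 ^ f (4 ^ e) \<and> ?P z} * ?u ^ card S"
    by (rule mult_le_mono1)
  then have "2 ^ f (4 ^ e) * ?q ^ card S \<le> card {z. z < 2 ^ f (4 ^ e) \<and> ?P z} * ?u ^ card S"
    using trap unfolding trap_def card_lessThan by linarith
  then have "trap_code T f k S e l (prod_encode (y, t))"
    unfolding trap_code_def card_lessThan_sum by simp
  then show ?thesis by blast
qed

subsection \<open>Length bounds for extractors\<close>

text \<open>The hypothetical witnesses, each \<open>\<Gamma> i\<close> accompanied by a function
  \<open>h i\<close> on codes and a stagewise evaluation \<open>T i\<close>. The relation between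
  \<open>\<alpha>\<close> and \<open>\<beta>\<close> enters later, when the two length bounds are
  compared.\<close>

locale extractor =
  fixes U :: "bool list \<Rightarrow> bool list option" and k :: nat and \<alpha> \<beta> :: real
    and f :: "nat \<Rightarrow> nat" and \<Gamma> :: "nat \<Rightarrow> bool list \<Rightarrow> bool list option" and d :: nat
    and h :: "nat \<Rightarrow> nat \<Rightarrow> nat option" and T :: "nat \<Rightarrow> nat \<Rightarrow> nat \<Rightarrow> nat"
  assumes U: "optimal_machine U"
    and k_pos: "0 < k"
    and \<alpha>: "0 < \<alpha>" "\<alpha> < 1" and \<beta>: "0 < \<beta>" "\<beta> < 1"
    and f: "computable_nat f"
    and extr: "extracts U k \<alpha> \<beta> f \<Gamma> d"
    and h: "\<And>i. i \<in> {1..k} \<Longrightarrow> partial_recursive (h i)"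
    and h_str_code: "\<And>i s. i \<in> {1..k} \<Longrightarrow> h i (str_code s) = map_option str_code (\<Gamma> i s)"
    and T: "\<And>i. i \<in> {1..k} \<Longrightarrow> stages (h i) (T i)"
begin

lemma length_output:
  "length \<sigma> = f n \<Longrightarrow> i \<in> {1..k} \<Longrightarrow> \<Gamma> i \<sigma> = Some \<tau> \<Longrightarrow> length \<tau> = n"
  using extr unfolding extracts_def by blast

lemma complex_output:
  assumes "length \<sigma> = f n" "\<alpha> * real (f n) + real d \<le> real (plain_complexity U \<sigma>)"
  obtains i \<tau> where "i \<in> {1..k}" "\<Gamma> i \<sigma> = Some \<tau>" "\<beta> * real n - real d \<le> real (plain_complexity U \<tau>)"
proof -
  have "\<exists>i\<in>{1..k}. \<exists>\<tau>. \<Gamma> i \<sigma> = Some \<tau> \<and> \<beta> * real (length \<tau>) - real d \<le> real (plain_complexity U \<tau>)"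
    using extr assms unfolding extracts_def by metis
  then show thesis using that length_output[OF assms(1)] by blast
qed

text \<open>Supplies the set of \<open>2 ^ n\<close> possible outputs among which popular values are
  chosen, and the bound on the digits of a trap code.\<close>

lemma output_range:
  assumes "i \<in> {1..k}" "z < 2 ^ f n" "h i (2 ^ f n - 1 + z) = Some b"
  shows "b \<in> {2 ^ n - 1..<2 ^ Suc n - 1}"
proof -
  obtain \<sigma> where \<sigma>: "str_code \<sigma> = 2 ^ f n - 1 + z" by (rule str_code_surj)
  have len: "length \<sigma> = f n" using length_eq_if_str_code[OF \<sigma> assms(2)] .
  have "map_option str_code (\<Gamma> i \<sigma>) = Some b" using assms(3) h_str_code[OF assms(1), of \<sigma>] \<sigma> by simp
  then obtain \<tau> where \<tau>: "\<Gamma> i \<sigma> = Some \<tau>" "b = str_code \<tau>" by blast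
  have n: "length \<tau> = n" using length_output[OF len assms(1) \<tau>(1)] .
  have "2 ^ n \<le> Suc b \<and> Suc b < 2 ^ Suc n" using str_code_bounds[of \<tau>] unfolding n \<tau>(2) .
  then show ?thesis unfolding atLeastLessThan_iff by linarith
qed

section \<open>Input length from below: outputs are hardly more complex than inputs\<close>

text \<open>The parameter \<open>e\<close> and the offset \<open>x\<close> determine the input, and
  applying \<open>h i\<close> costs a constant. Summing these constants over \<open>i\<close> makes
  the bound uniform.\<close>

lemma output_complexity_bound:
  "\<exists>c. \<forall>i\<in>{1..k}. \<forall>e l x s. x < 2 ^ l \<longrightarrow> h i (2 ^ f (4 ^ e) - 1 + x) = Some (str_code s) \<longrightarrow>
     plain_complexity U s \<le> l + e + c"
proof -
  have "\<exists>c. i \<in> {1..k} \<longrightarrow> (\<forall>e l x s. x < 2 ^ l \<longrightarrow> h i (2 ^ f (4 ^ e) - 1 + x) = Some (str_code s) \<longrightarrow>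
     plain_complexity U s \<le> l + e + c)" for i
  proof (cases "i \<in> {1..k}")
    case True
    define g where "g N = 2 ^ f (4 ^ val2 N) - 1 + N div 2 ^ Suc (val2 N)" for N
    have "computable_nat g" unfolding g_def
      by (intro computable_intros computable_nat_comp[OF f] computable_nat_val2 computable_nat_div)
    then have "partial_recursive (\<lambda>N. Option.bind (Some (g N)) (h i))"
      unfolding computable_nat_def using partial_recursive.comp[OF h[OF True]] by blast
    moreover have "Option.bind (Some (g (2 ^ e * (2 * x + 1)))) (h i) = h i (2 ^ f (4 ^ e) - 1 + x)" for e x
      unfolding g_def val2_eq div_val2 by simp
    ultimately show ?thesis using complexity_le_of_parameter[OF U] by metis
  qed blast
  then obtain c where c: "\<And>i e l x s. i \<in> {1..k} \<Longrightarrow> x < 2 ^ l \<Longrightarrow>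
      h i (2 ^ f (4 ^ e) - 1 + x) = Some (str_code s) \<Longrightarrow> plain_complexity U s \<le> l + e + c i"
    by metis
  have "plain_complexity U s \<le> l + e + (\<Sum>i\<in>{1..k}. c i)"
    if "i \<in> {1..k}" "x < 2 ^ l" "h i (2 ^ f (4 ^ e) - 1 + x) = Some (str_code s)" for i e l x s
    using c[OF that] member_le_sum[of i "{1..k}" c] that(1) by fastforce
  then show ?thesis by blast
qed

text \<open>With \<open>l\<close> the least integer above or equal to
  \<open>\<alpha> * m + d\<close>, the premise gives \<open>l \<le> m\<close>. Fewer than
  \<open>2 ^ l\<close> strings have complexity below \<open>l\<close>, so one of the first
  \<open>2 ^ l\<close> inputs is complex enough to need an output of complexity
  \<open>\<beta> * n - d\<close>; yet its small offset bounds that output by about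
  \<open>l + e\<close>.\<close>

lemma output_length_le:
  "\<exists>c::nat. \<forall>e. \<alpha> * real (f (4 ^ e)) + real d + 1 \<le> real (f (4 ^ e)) \<longrightarrow>
     \<beta> * 4 ^ e \<le> \<alpha> * real (f (4 ^ e)) + real e + real c"
proof -
  obtain c where c: "\<And>i e l x s. i \<in> {1..k} \<Longrightarrow> x < 2 ^ l \<Longrightarrow>
      h i (2 ^ f (4 ^ e) - 1 + x) = Some (str_code s) \<Longrightarrow> plain_complexity U s \<le> l + e + c"
    using output_complexity_bound by blast
  have "\<beta> * 4 ^ e \<le> \<alpha> * real (f (4 ^ e)) + real e + real (c + 2 * d + 1)"
    if room: "\<alpha> * real (f (4 ^ e)) + real d + 1 \<le> real (f (4 ^ e))" for e
  proof -
    define m where "m = f (4 ^ e)"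
    define l where "l = nat \<lceil>\<alpha> * real m + real d\<rceil>"
    have nn: "0 \<le> \<alpha> * real m + real d" using \<alpha> by simp
    have l: "\<alpha> * real m + real d \<le> real l" "real l < \<alpha> * real m + real d + 1"
      using nn unfolding l_def by linarith+
    have lm: "l \<le> m" using l(2) room unfolding m_def[symmetric] by linarith
    let ?A = "{s. \<exists>x<2 ^ l. str_code s = 2 ^ m - 1 + x}"
    have im: "str_code ` ?A = (\<lambda>x. 2 ^ m - 1 + x) ` {..<2 ^ l}"
    proof (intro equalityI subsetI)
      fix y :: nat assume "y \<in> (\<lambda>x. 2 ^ m - 1 + x) ` {..<2 ^ l}"
      then obtain x where x: "x < 2 ^ l" "y = 2 ^ m - 1 + x" by blast
      obtain s where "str_code s = y" by (rule str_code_surj)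
      then show "y \<in> str_code ` ?A" using x by blast
    qed blast
    have "card ?A = card (str_code ` ?A)"
      by (rule card_image[symmetric]) (simp add: inj_on_def str_code_inj)
    also have "\<dots> = 2 ^ l" unfolding im by (subst card_image) (auto intro: inj_onI dest: add_left_imp_eq)
    finally have "card ?A = 2 ^ l" .
    have "\<not> ?A \<subseteq> {s. plain_complexity U s < l}"
    proof
      assume "?A \<subseteq> {s. plain_complexity U s < l}"
      from card_mono[OF finite_complexity_less(1)[OF U] this] finite_complexity_less(2)[OF U, of l]
      show False using \<open>card ?A = 2 ^ l\<close> by linarith
    qed
    then obtain \<sigma> where "\<sigma> \<in> ?A" "l \<le> plain_complexity U \<sigma>" using not_less by blast
    then obtain x where \<sigma>: "x < 2 ^ l" "str_code \<sigma> = 2 ^ m - 1 + x" "l \<le> plain_complexity U \<sigma>"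
      by blast
    have "(2::nat) ^ l \<le> 2 ^ m" using lm by (intro power_increasing) auto
    then have len: "length \<sigma> = f (4 ^ e)"
      using length_eq_if_str_code[OF \<sigma>(2)] \<sigma>(1) unfolding m_def by linarith
    have "\<alpha> * real (f (4 ^ e)) + real d \<le> real (plain_complexity U \<sigma>)"
      using l(1) \<sigma>(3) unfolding m_def by linarith
    then obtain i \<tau> where \<tau>: "i \<in> {1..k}" "\<Gamma> i \<sigma> = Some \<tau>"
      "\<beta> * real (4 ^ e) - real d \<le> real (plain_complexity U \<tau>)"
      using complex_output[OF len] by blast
    have "h i (2 ^ f (4 ^ e) - 1 + x) = Some (str_code \<tau>)"
      using h_str_code[OF \<tau>(1), of \<sigma>] \<tau>(2) \<sigma>(2) unfolding m_def by simp
    from c[OF \<tau>(1) \<sigma>(1) this] have "plain_complexity U \<tau> \<le> l + e + c" .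
    then have "\<beta> * real (4 ^ e) - real d \<le> real l + real e + real c" using \<tau>(3) by linarith
    then show ?thesis using l(2) unfolding m_def by simp
  qed
  then show ?thesis by blast
qed

section \<open>Input length from above: trapping the outputs\<close>

text \<open>For fixed \<open>S\<close> the least trap code is found from \<open>e\<close> and
  \<open>l\<close> alone, so an element of that trap is described by \<open>e\<close>,
  \<open>l\<close> and its position \<open>j\<close>. There is one constant for each
  \<open>S\<close>, and their sum serves all subsets.\<close>

lemma trap_elements_simple:
  "\<exists>c. \<forall>S\<subseteq>{1..k}. \<forall>e l. (\<exists>w. trap_code T f k S e l w) \<longrightarrow>
     (\<exists>w. trap_code T f k S e l w \<and> (\<forall>j<card S * (2 ^ l div k). \<forall>s.
        digit (2 ^ Suc (4 ^ e)) (fst (prod_decode w)) j = str_code s \<longrightarrow> plain_complexity U s \<le> l + e + c))"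
proof -
  have "\<exists>c. S \<subseteq> {1..k} \<longrightarrow> (\<forall>e l. (\<exists>w. trap_code T f k S e l w) \<longrightarrow>
     (\<forall>j<card S * (2 ^ l div k). \<forall>s.
        digit (2 ^ Suc (4 ^ e)) (fst (prod_decode (LEAST w. trap_code T f k S e l w))) j = str_code s \<longrightarrow>
        plain_complexity U s \<le> l + e + c))" for S
  proof (cases "S \<subseteq> {1..k}")
    case True
    then have finS: "finite S" and cS: "card S \<le> k"
      using finite_subset card_mono[of "{1..k}" S] by auto
    have T': "computable_nat2 (T i)" if "i \<in> S" for i using T that True unfolding stages_def by blast
    define X where "X N = N div 2 ^ Suc (val2 N)" for N
    have X: "computable_nat X" unfolding X_def
      by (intro computable_nat_div computable_intros computable_nat_val2)
    define P where "P N w \<longleftrightarrow> trap_code T f k S (val2 N) (lg2 (X N)) w" for N w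
    define G where "G N w = digit (2 ^ Suc (4 ^ val2 N)) (fst (prod_decode w)) (X N - 2 ^ lg2 (X N))" for N w
    have "decidable (\<lambda>p. P (fst (prod_decode p)) (snd (prod_decode p)))" unfolding P_def
      by (intro decidable_trap_code T' f finS computable_nat_val2 computable_nat_lg2
          computable_nat_comp[OF X] computable_intros)
    moreover have "computable_nat2 G" unfolding G_def computable_nat2_def
      by (intro computable_nat_digit computable_nat_val2 computable_nat_lg2
          computable_nat_comp[OF X] computable_intros)
    ultimately obtain M where M: "partial_recursive M"
      "\<And>a. \<exists>w. P a w \<Longrightarrow> M a = Some (G a (LEAST w. P a w))"
      using partial_recursive_Least_search by metis
    obtain c where c: "\<And>e l x s. x < 2 ^ l \<Longrightarrow> M (2 ^ e * (2 * x + 1)) = Some (str_code s) \<Longrightarrow>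
        plain_complexity U s \<le> l + e + c"
      using complexity_le_of_parameter[OF U M(1)] by blast
    have "plain_complexity U s \<le> l + e + Suc c"
      if ex: "\<exists>w. trap_code T f k S e l w" and j: "j < card S * (2 ^ l div k)"
        and s: "digit (2 ^ Suc (4 ^ e)) (fst (prod_decode (LEAST w. trap_code T f k S e l w))) j = str_code s"
      for e l j s
    proof -
      \<comment> \<open>This is the reason for the block size \<open>2 ^ l div k\<close>: all
        positions fit into \<open>l\<close> bits.\<close>
      have "card S * (2 ^ l div k) \<le> k * (2 ^ l div k)" using cS by (rule mult_le_mono1)
      also have "\<dots> \<le> 2 ^ l" by (rule times_div_less_eq_dividend)
      finally have j': "j < 2 ^ l" using j by linarith
      \<comment> \<open>The leading bit of \<open>2 ^ l + j\<close> transmits \<open>l\<close> at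
        the price of one bit.\<close>
      define N where "N = 2 ^ e * (2 * (2 ^ l + j) + 1)"
      have N: "val2 N = e" "X N = 2 ^ l + j" "lg2 (2 ^ l + j) = l"
        unfolding N_def X_def val2_eq div_val2 lg2_eq[OF j'] by simp_all
      have P: "P N = trap_code T f k S e l" by (intro ext) (simp only: P_def N)
      have "M N = Some (str_code s)"
        using M(2)[of N] ex unfolding P G_def N by (simp add: s del: power_Suc)
      moreover have "2 ^ l + j < 2 ^ Suc l" using j' by simp
      ultimately have "plain_complexity U s \<le> Suc l + e + c" using c unfolding N_def by blast
      then show ?thesis by simp
    qed
    then show ?thesis by blast
  qed blast
  then obtain c where c: "\<And>S e l j s. S \<subseteq> {1..k} \<Longrightarrow> \<exists>w. trap_code T f k S e l w \<Longrightarrow>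
      j < card S * (2 ^ l div k) \<Longrightarrow>
      digit (2 ^ Suc (4 ^ e)) (fst (prod_decode (LEAST w. trap_code T f k S e l w))) j = str_code s \<Longrightarrow>
      plain_complexity U s \<le> l + e + c S"
    by metis
  have cS: "c S \<le> (\<Sum>S\<in>Pow {1..k}. c S)" if "S \<subseteq> {1..k}" for S
    using that by (intro member_le_sum) auto
  have bound: "plain_complexity U s \<le> l + e + (\<Sum>S\<in>Pow {1..k}. c S)"
    if "S \<subseteq> {1..k}" "\<exists>w. trap_code T f k S e l w" "j < card S * (2 ^ l div k)"
      "digit (2 ^ Suc (4 ^ e)) (fst (prod_decode (LEAST w. trap_code T f k S e l w))) j = str_code s"
    for S e l j s
    using c[OF that] cS[OF that(1)] by linarith
  show ?thesis
  proof (rule exI[of _ "\<Sum>S\<in>Pow {1..k}. c S"], intro allI impI)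
    fix S e l assume S: "S \<subseteq> {1..k}" and ex: "\<exists>w. trap_code T f k S e l w"
    show "\<exists>w. trap_code T f k S e l w \<and> (\<forall>j<card S * (2 ^ l div k). \<forall>s.
        digit (2 ^ Suc (4 ^ e)) (fst (prod_decode w)) j = str_code s \<longrightarrow>
        plain_complexity U s \<le> l + e + (\<Sum>S\<in>Pow {1..k}. c S))"
      using LeastI_ex[OF ex] bound[OF S ex]
      by (intro exI[of _ "LEAST w. trap_code T f k S e l w"] conjI allI impI)
  qed
qed

text \<open>The premise puts the complexity of all trap elements below
  \<open>\<beta> * n - d\<close>. An input whose defined outputs all lie in the trap then has
  complexity below \<open>\<alpha> * m + d\<close>; the number of such inputs is bounded below by
  \<open>maximal_trap\<close> and above by counting programs.\<close>

lemma trapped_inputs_count: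
  "\<exists>c::nat. \<forall>e l. l \<le> 4 ^ e \<longrightarrow> real l + real e + real c < \<beta> * 4 ^ e - real d \<longrightarrow>
     2 ^ f (4 ^ e) * (2 ^ l div k) ^ k \<le>
     2 * 2 ^ nat \<lceil>\<alpha> * real (f (4 ^ e)) + real d\<rceil> * (2 * k * 2 ^ (4 ^ e)) ^ k"
proof -
  obtain c where c0: "\<forall>S\<subseteq>{1..k}. \<forall>e l. (\<exists>w. trap_code T f k S e l w) \<longrightarrow>
     (\<exists>w. trap_code T f k S e l w \<and> (\<forall>j<card S * (2 ^ l div k). \<forall>s.
        digit (2 ^ Suc (4 ^ e)) (fst (prod_decode w)) j = str_code s \<longrightarrow> plain_complexity U s \<le> l + e + c))"
    using trap_elements_simple by (elim exE)
  note c = c0[rule_format]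
  have "2 ^ f (4 ^ e) * (2 ^ l div k) ^ k \<le>
     2 * 2 ^ nat \<lceil>\<alpha> * real (f (4 ^ e)) + real d\<rceil> * (2 * k * 2 ^ (4 ^ e)) ^ k"
    if ln: "l \<le> 4 ^ e" and small: "real l + real e + real c < \<beta> * 4 ^ e - real d" for e l
  proof -
    define n :: nat where "n = 4 ^ e"
    let ?g = "\<lambda>i z. h i (2 ^ f n - 1 + z)" and ?Z = "{..<2 ^ f n} :: nat set"
    let ?q = "2 ^ l div k" and ?V = "{2 ^ n - 1..<2 ^ Suc n - 1} :: nat set"
    let ?u = "2 * k * 2 ^ n"
    let ?L = "nat \<lceil>\<alpha> * real (f n) + real d\<rceil>"
    have cV: "card ?V = 2 ^ n" by simp
    have "?q \<le> 2 ^ l" by simp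
    also have "(2::nat) ^ l \<le> 2 ^ n" using ln unfolding n_def by (intro power_increasing) auto
    finally have q: "?q \<le> card ?V" unfolding cV .
    have cK: "card {1..k} = k" by simp
    have gV: "b \<in> ?V" if "i \<in> {1..k}" "z \<in> ?Z" "?g i z = Some b" for i z b
      using output_range[OF that(1) _ that(3)] that(2) by blast
    have "\<exists>S\<subseteq>{1..k}. (\<exists>B. trap ?g ?Z ?q (2 * k * card ?V) S B) \<and>
      (\<forall>B. trap ?g ?Z ?q (2 * k * card ?V) S B \<longrightarrow> card ?Z * ?q ^ k \<le>
        2 * card {z \<in> ?Z. \<forall>i\<in>{1..k}. \<forall>b. ?g i z = Some b \<longrightarrow> b \<in> B} * (2 * k * card ?V) ^ k)"
      by (rule maximal_trap[OF finite_lessThan finite_atLeastLessThan q finite_atLeastAtMost cK k_pos])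
        (rule gV)
    then obtain S B0 where S: "S \<subseteq> {1..k}" "trap ?g ?Z ?q ?u S B0"
      and max: "\<forall>B. trap ?g ?Z ?q ?u S B \<longrightarrow>
        card ?Z * ?q ^ k \<le> 2 * card {z \<in> ?Z. \<forall>i\<in>{1..k}. \<forall>b. ?g i z = Some b \<longrightarrow> b \<in> B} * ?u ^ k"
      unfolding cV by (elim exE conjE)
    have TS: "stages (h i) (T i)" if "i \<in> S" for i using T S(1) that by blast
    have finS: "finite S" using S(1) finite_subset by blast
    have "\<exists>w. trap_code T f k S e l w"
    proof (rule trap_code_complete[OF TS finS])
      fix i z b assume "i \<in> S" "z < 2 ^ f (4 ^ e)" "h i (2 ^ f (4 ^ e) - 1 + z) = Some b"
      then have "b \<in> ?V" using gV[of i z b] S(1) unfolding n_def by blast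
      then show "b < 2 ^ Suc (4 ^ e)" unfolding n_def atLeastLessThan_iff by linarith
    qed (use S(2) in \<open>simp_all add: n_def\<close>)
    from c[OF S(1) this] obtain w where w: "trap_code T f k S e l w"
      and simple: "\<forall>j<card S * ?q. \<forall>s. digit (2 ^ Suc (4 ^ e)) (fst (prod_decode w)) j = str_code s \<longrightarrow>
          plain_complexity U s \<le> l + e + c"
      by (elim exE conjE)
    define B where "B = digit (2 ^ Suc (4 ^ e)) (fst (prod_decode w)) ` {..<card S * ?q}"
    define G where "G = {z \<in> ?Z. \<forall>i\<in>{1..k}. \<forall>b. ?g i z = Some b \<longrightarrow> b \<in> B}"
    \<comment> \<open>The trap found by the search may differ from \<open>B0\<close>, but it lies
      over the same \<open>S\<close>, so \<open>max\<close> applies to it.\<close>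
    have "trap ?g ?Z ?q ?u S B"
      using trap_code_sound[OF TS w] unfolding B_def n_def .
    from max[rule_format, OF this] have main: "2 ^ f n * ?q ^ k \<le> 2 * card G * ?u ^ k"
      unfolding G_def card_lessThan .
    have "(\<lambda>z. 2 ^ f n - 1 + z) ` G \<subseteq> str_code ` {s. plain_complexity U s < ?L}"
    proof (rule image_subsetI)
      fix z assume z: "z \<in> G"
      obtain \<sigma> where \<sigma>: "str_code \<sigma> = 2 ^ f n - 1 + z" by (rule str_code_surj)
      have len: "length \<sigma> = f n" using length_eq_if_str_code[OF \<sigma>] z unfolding G_def by simp
      have "real (plain_complexity U \<sigma>) < \<alpha> * real (f n) + real d"
      proof (rule ccontr)
        assume "\<not> ?thesis"
        then have "\<alpha> * real (f n) + real d \<le> real (plain_complexity U \<sigma>)" by simp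
        from complex_output[OF len this] obtain i \<tau> where \<tau>: "i \<in> {1..k}" "\<Gamma> i \<sigma> = Some \<tau>"
          "\<beta> * real n - real d \<le> real (plain_complexity U \<tau>)" by blast
        have "?g i z = Some (str_code \<tau>)" using h_str_code[OF \<tau>(1), of \<sigma>] \<tau>(2) \<sigma> by simp
        then have "str_code \<tau> \<in> B" using z \<tau>(1) unfolding G_def by blast
        then obtain j where "j < card S * ?q" "digit (2 ^ Suc (4 ^ e)) (fst (prod_decode w)) j = str_code \<tau>"
          unfolding B_def by (metis imageE lessThan_iff)
        then have "plain_complexity U \<tau> \<le> l + e + c" using simple by blast
        then show False using \<tau>(3) small unfolding n_def by simp
      qed
      then have "plain_complexity U \<sigma> < ?L" by linarith
      then show "2 ^ f n - 1 + z \<in> str_code ` {s. plain_complexity U s < ?L}" using \<sigma> by (metis (mono_tags) image_eqI mem_Collect_eq)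
    qed
    then have "card ((\<lambda>z. 2 ^ f n - 1 + z) ` G) \<le> card {s. plain_complexity U s < ?L}"
      by (rule surj_card_le[OF finite_complexity_less(1)[OF U]])
    then have "card G \<le> 2 ^ ?L"
      using finite_complexity_less(2)[OF U, of ?L] by (subst (asm) card_image) (auto intro: inj_onI dest: add_left_imp_eq)
    then have "2 * card G * ?u ^ k \<le> 2 * 2 ^ ?L * ?u ^ k" by (intro mult_le_mono) auto
    with main show ?thesis unfolding n_def by linarith
  qed
  then show ?thesis by blast
qed

text \<open>\<open>l\<close> is taken nearly as large as \<open>trapped_inputs_count\<close>
  permits; comparing exponents of two then gives the bound.\<close>

lemma input_length_le:
  "\<exists>c A :: nat. \<forall>e. real e + real A \<le> \<beta> * 4 ^ e \<longrightarrow>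
     (1 - \<alpha>) * real (f (4 ^ e)) \<le> real k * (1 - \<beta>) * 4 ^ e + real k * real e + real c"
proof -
  obtain c :: nat where c: "\<And>e l. l \<le> 4 ^ e \<Longrightarrow> real l + real e + real c < \<beta> * 4 ^ e - real d \<Longrightarrow>
     2 ^ f (4 ^ e) * (2 ^ l div k) ^ k \<le>
     2 * 2 ^ nat \<lceil>\<alpha> * real (f (4 ^ e)) + real d\<rceil> * (2 * k * 2 ^ (4 ^ e)) ^ k"
    using trapped_inputs_count by blast
  have "(1 - \<alpha>) * real (f (4 ^ e)) \<le> real k * (1 - \<beta>) * 4 ^ e + real k * real e
      + real (k * (d + c + 2) + d + 2 + k * (2 + 2 * k))"
    if A: "real e + real (d + c + k + 2) \<le> \<beta> * 4 ^ e" for e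
  proof -
    define n :: nat where "n = 4 ^ e"
    define m where "m = f n"
    define \<rho> where "\<rho> = \<beta> * real n - real d - real e - real c"
    have n4: "real n = 4 ^ e" unfolding n_def by simp
    have \<rho>: "real k + 2 \<le> \<rho>" using A unfolding \<rho>_def n4 by simp
    \<comment> \<open>Subtracting \<open>1\<close> makes the complexity condition strict, and
      \<open>\<rho> \<ge> k + 2\<close> gives \<open>l \<ge> k\<close>, so that the block size
      \<open>2 ^ l div k\<close> is positive.\<close>
    define l where "l = nat (\<lfloor>\<rho>\<rfloor> - 1)"
    have l: "real l \<le> \<rho> - 1" "\<rho> - 2 < real l" "k \<le> l" using \<rho> unfolding l_def by linarith+
    have "\<beta> * real n \<le> real n" using \<beta> by (simp add: mult_left_le_one_le)
    then have "real l \<le> real n" using l(1) unfolding \<rho>_def by linarith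
    then have ln: "l \<le> 4 ^ e" unfolding n_def by linarith
    have sm: "real l + real e + real c < \<beta> * 4 ^ e - real d"
      using l(1) unfolding \<rho>_def n4 by linarith
    let ?L = "nat \<lceil>\<alpha> * real m + real d\<rceil>"
    let ?q = "2 ^ l div k"
    have main: "2 ^ m * ?q ^ k \<le> 2 * 2 ^ ?L * (2 * k * 2 ^ n) ^ k"
      using c[OF ln sm] unfolding n_def m_def .
    have "k < 2 ^ k" by (rule less_exp)
    also have "(2::nat) ^ k \<le> 2 ^ l" using l(3) by (intro power_increasing) auto
    finally have kl: "k < 2 ^ l" .
    then have "1 \<le> ?q" using k_pos by (simp add: Suc_le_eq div_greater_zero_iff)
    \<comment> \<open>As \<open>?q\<close> is at least \<open>1\<close>, rounding in the division
      costs at most a factor \<open>2\<close>.\<close>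
    have "2 ^ l < k * Suc ?q"
      using k_pos by (metis dividend_less_times_div mult_Suc_right add.commute)
    also have "\<dots> \<le> k * (2 * ?q)" using \<open>1 \<le> ?q\<close> by (intro mult_le_mono2) simp
    finally have "2 ^ l \<le> 2 * k * ?q" by simp
    then have "(2 ^ l) ^ k \<le> (2 * k * ?q) ^ k" by (intro power_mono) auto
    then have "2 ^ m * (2 ^ l) ^ k \<le> 2 ^ m * (2 * k * ?q) ^ k" by (rule mult_le_mono2)
    also have "\<dots> = (2 ^ m * ?q ^ k) * (2 * k) ^ k" by (simp only: power_mult_distrib mult_ac)
    also have "\<dots> \<le> (2 * 2 ^ ?L * (2 * k * 2 ^ n) ^ k) * (2 * k) ^ k"
      using main by (rule mult_le_mono1)
    also have "\<dots> = 2 * 2 ^ ?L * ((2 * k) * (2 * k) * 2 ^ n) ^ k"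
      by (simp only: power_mult_distrib mult_ac)
    \<comment> \<open>Bounding \<open>2 * k\<close> by \<open>2 ^ Suc k\<close> makes both sides
      powers of two; the loss depends on \<open>k\<close> only.\<close>
    also have "\<dots> \<le> 2 * 2 ^ ?L * (2 ^ Suc k * 2 ^ Suc k * 2 ^ n) ^ k"
      using \<open>k < 2 ^ k\<close> by (intro mult_le_mono power_mono) auto
    also have "\<dots> = 2 ^ (1 + ?L + (Suc k + Suc k + n) * k)"
      by (simp only: power_add power_mult power_one_right)
    finally have "(2::nat) ^ (m + l * k) \<le> 2 ^ (1 + ?L + (Suc k + Suc k + n) * k)"
      by (simp only: power_add power_mult)
    then have "m + l * k \<le> 1 + ?L + (Suc k + Suc k + n) * k"
      by (rule power_le_imp_le_exp[rotated]) simp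
    then have "real (m + l * k) \<le> real (1 + ?L + (Suc k + Suc k + n) * k)" by (rule of_nat_mono)
    then have 1: "real m + real l * real k \<le> 1 + real ?L + (2 * real k + 2 + real n) * real k" 
      by (simp add: algebra_simps)
    have "0 \<le> \<alpha> * real m + real d" using \<alpha> by simp
    then have 2: "real ?L < \<alpha> * real m + real d + 1" by linarith
    have "(\<rho> - 2) * real k \<le> real l * real k" using l(2) by (intro mult_right_mono) auto
    then have "real m + (\<rho> - 2) * real k \<le> \<alpha> * real m + real d + 2 + (2 * real k + 2 + real n) * real k"
      using 1 2 by linarith
    then show ?thesis unfolding \<rho>_def n4[symmetric] m_def[symmetric] n_def[symmetric]
      by (simp add: algebra_simps)
  qed
  then show ?thesis by blast
qed

section \<open>Computing the threshold from the lengths\<close>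

text \<open>With \<open>\<omega> = 1 + (k - 1) * \<alpha>\<close> the relation gives
  \<open>\<beta> * \<omega> = k * \<alpha>\<close> and
  \<open>(1 - \<beta>) * \<omega> = 1 - \<alpha>\<close>. Scaling the two length bounds by
  \<open>\<omega> / \<alpha>\<close> and \<open>\<omega> / (1 - \<alpha>)\<close> therefore makes
  both compare \<open>k * n\<close> with \<open>\<omega> * m\<close>, up to an error linear in
  \<open>e\<close>.\<close>

lemma lengths_asymptotics:
  assumes inj: "inj f" and \<beta>_eq: "\<beta> * (1 + (real k - 1) * \<alpha>) = real k * \<alpha>"
  shows "\<exists>D E. 0 < D \<and> (\<forall>e\<ge>E. \<bar>real k * 4 ^ e - (1 + (real k - 1) * \<alpha>) * real (f (4 ^ e))\<bar> \<le> D * (real e + 1))"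
proof -
  define \<omega> where "\<omega> = 1 + (real k - 1) * \<alpha>"
  have "0 \<le> (real k - 1) * \<alpha>" using k_pos \<alpha> by simp
  then have \<omega>: "0 < \<omega>" unfolding \<omega>_def by linarith
  have \<beta>\<omega>: "\<beta> * \<omega> = real k * \<alpha>" "(1 - \<beta>) * \<omega> = 1 - \<alpha>"
    using \<beta>_eq unfolding \<omega>_def by (simp_all add: algebra_simps)
  obtain c :: nat where c: "\<And>e. \<alpha> * real (f (4 ^ e)) + real d + 1 \<le> real (f (4 ^ e)) \<Longrightarrow>
     \<beta> * 4 ^ e \<le> \<alpha> * real (f (4 ^ e)) + real e + real c"
    using output_length_le by blast
  obtain c' A :: nat where c': "\<And>e. real e + real A \<le> \<beta> * 4 ^ e \<Longrightarrow>
     (1 - \<alpha>) * real (f (4 ^ e)) \<le> real k * (1 - \<beta>) * 4 ^ e + real k * real e + real c'"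
    using input_length_le by blast
  obtain M :: nat where M: "(real d + 1) / (1 - \<alpha>) \<le> real M" using real_arch_simple by blast
  \<comment> \<open>Injectivity makes \<open>f\<close> exceed \<open>M\<close> from some point on,
    which provides the room required by \<open>output_length_le\<close>.\<close>
  have "finite (f -` {..<M})" using finite_vimageI[OF _ inj] by blast
  then obtain N where N: "\<And>n. n \<in> f -` {..<M} \<Longrightarrow> n < N"
    using finite_nat_set_iff_bounded by metis
  \<comment> \<open>For \<open>e \<ge> E\<close> one has \<open>\<beta> * 2 ^ e \<ge> 1 + A\<close>,
    hence \<open>\<beta> * 4 ^ e \<ge> (1 + A) * 2 ^ e \<ge> e + A\<close>.\<close>
  obtain E :: nat where E: "(1 + real A) / \<beta> \<le> real E" using real_arch_simple by blast
  define D where "D = \<omega> / \<alpha> * (1 + real c) + \<omega> / (1 - \<alpha>) * (real k + real c')"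
  have D0: "0 < \<omega> / \<alpha> * (1 + real c)" "0 < \<omega> / (1 - \<alpha>) * (real k + real c')"
    using \<omega> \<alpha> k_pos by (simp_all add: add_pos_nonneg)
  have "\<bar>real k * 4 ^ e - \<omega> * real (f (4 ^ e))\<bar> \<le> D * (real e + 1)" if e: "max N E \<le> e" for e
  proof -
    define m where "m = real (f (4 ^ e))"
    define n :: real where "n = 4 ^ e"
    have e2: "real e \<le> 2 ^ e" using less_exp[of e] by (metis less_imp_le of_nat_le_iff of_nat_numeral of_nat_power)
    have 4: "n = 2 ^ e * 2 ^ e" unfolding n_def by (simp add: power_mult_distrib[symmetric])
    have "M \<le> f (4 ^ e)"
    proof (rule ccontr)
      assume "\<not> ?thesis"
      then have "4 ^ e < N" using N[of "4 ^ e"] by simp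
      moreover have "e < 4 ^ e" by (induction e) auto
      ultimately show False using e by simp
    qed
    then have "(real d + 1) / (1 - \<alpha>) \<le> m" using M unfolding m_def by linarith
    then have "real d + 1 \<le> m * (1 - \<alpha>)" using \<alpha> by (simp add: pos_divide_le_eq)
    then have "\<alpha> * m + real d + 1 \<le> m" by (simp add: algebra_simps)
    from c[OF this[unfolded m_def]] have "\<beta> * n \<le> \<alpha> * m + (real e + real c)" unfolding m_def n_def by simp
    then have "(\<omega> / \<alpha>) * (\<beta> * n) \<le> (\<omega> / \<alpha>) * (\<alpha> * m + (real e + real c))"
      using \<omega> \<alpha> by (intro mult_left_mono) auto
    moreover have "(\<omega> / \<alpha>) * (\<beta> * n) = (\<beta> * \<omega>) * n / \<alpha>" by simp
    moreover have "(\<omega> / \<alpha>) * (\<alpha> * m + (real e + real c)) = \<omega> * m + \<omega> / \<alpha> * (real e + real c)"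
      using \<alpha> by (simp add: field_simps)
    ultimately have up: "real k * n \<le> \<omega> * m + \<omega> / \<alpha> * (real e + real c)"
      unfolding \<beta>\<omega> using \<alpha> by simp
    have "(1 + real A) / \<beta> \<le> 2 ^ e" using E e e2 by linarith
    then have "1 + real A \<le> 2 ^ e * \<beta>" using \<beta> by (simp add: pos_divide_le_eq)
    then have "(1 + real A) * 2 ^ e \<le> 2 ^ e * \<beta> * 2 ^ e" by (rule mult_right_mono) simp
    then have "2 ^ e + real A * 2 ^ e \<le> \<beta> * n" unfolding 4 by (simp add: algebra_simps)
    moreover have "real A * 1 \<le> real A * 2 ^ e" by (intro mult_left_mono) auto
    ultimately have "real e + real A \<le> \<beta> * n" using e2 by linarith
    from c'[OF this[unfolded n_def]]
    have "(1 - \<alpha>) * m \<le> real k * (1 - \<beta>) * n + (real k * real e + real c')" unfolding m_def n_def by simp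
    then have "(\<omega> / (1 - \<alpha>)) * ((1 - \<alpha>) * m) \<le> (\<omega> / (1 - \<alpha>)) * (real k * (1 - \<beta>) * n + (real k * real e + real c'))"
      using \<omega> \<alpha> by (intro mult_left_mono) auto
    moreover have "(\<omega> / (1 - \<alpha>)) * ((1 - \<alpha>) * m) = \<omega> * m" using \<alpha> by simp
    moreover have "(\<omega> / (1 - \<alpha>)) * (real k * (1 - \<beta>) * n + (real k * real e + real c')) =
        ((1 - \<beta>) * \<omega>) / (1 - \<alpha>) * (real k * n) + \<omega> / (1 - \<alpha>) * (real k * real e + real c')"
      by (simp add: distrib_left add_divide_distrib mult_ac)
    ultimately have lo: "\<omega> * m \<le> real k * n + \<omega> / (1 - \<alpha>) * (real k * real e + real c')"
      unfolding \<beta>\<omega> using \<alpha> by simp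
    have "real e + real c \<le> (1 + real c) * (real e + 1)"
      "real k * real e + real c' \<le> (real k + real c') * (real e + 1)"
      by (simp_all add: algebra_simps)
    then have "\<omega> / \<alpha> * (real e + real c) \<le> \<omega> / \<alpha> * ((1 + real c) * (real e + 1))"
      "\<omega> / (1 - \<alpha>) * (real k * real e + real c') \<le> \<omega> / (1 - \<alpha>) * ((real k + real c') * (real e + 1))"
      using \<omega> \<alpha> by (auto intro!: mult_left_mono simp del: times_divide_eq_left)
    moreover have "D * (real e + 1) = \<omega> / \<alpha> * ((1 + real c) * (real e + 1)) +
        \<omega> / (1 - \<alpha>) * ((real k + real c') * (real e + 1))"
      unfolding D_def by (simp only: distrib_right mult.assoc)
    moreover have "0 \<le> \<omega> / \<alpha> * ((1 + real c) * (real e + 1))"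
      "0 \<le> \<omega> / (1 - \<alpha>) * ((real k + real c') * (real e + 1))"
      using \<omega> \<alpha> by auto
    ultimately have "\<bar>real k * n - \<omega> * m\<bar> \<le> D * (real e + 1)" using up lo by linarith
    then show ?thesis unfolding n_def m_def .
  qed
  moreover have "0 < D" unfolding D_def using D0 by linarith
  ultimately show ?thesis unfolding \<omega>_def by blast
qed

text \<open>Solving \<open>k * n = \<omega> * m\<close> for \<open>\<alpha>\<close> suggests the
  approximation \<open>(k * n - m) / ((k - 1) * m)\<close>. Its error is at most
  \<open>2 * D / 2 ^ e\<close>, since \<open>4 ^ e\<close> outgrows the error linear in
  \<open>e\<close>.\<close>

lemma computable_threshold:
  assumes k2: "2 \<le> k" and inj: "inj f" and \<beta>_eq: "\<beta> * (1 + (real k - 1) * \<alpha>) = real k * \<alpha>"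
  shows "computable_real \<alpha>"
proof -
  define \<omega> where "\<omega> = 1 + (real k - 1) * \<alpha>"
  obtain D E where D: "0 < D" and DE: "\<And>e. E \<le> e \<Longrightarrow> \<bar>real k * 4 ^ e - \<omega> * real (f (4 ^ e))\<bar> \<le> D * (real e + 1)"
    using lengths_asymptotics[OF inj \<beta>_eq] unfolding \<omega>_def by blast
  have "(real k - 1) * \<alpha> \<le> real k - 1" "0 \<le> (real k - 1) * \<alpha>"
    using k2 \<alpha> mult_left_le[of \<alpha> "real k - 1"] by simp_all
  then have \<omega>: "0 < \<omega>" "\<omega> \<le> real k" unfolding \<omega>_def by linarith+
  obtain E' :: nat where E': "2 * D \<le> real E'" using real_arch_simple by blast
  \<comment> \<open>The shift \<open>F\<close> puts \<open>e = j + F\<close> in the range of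
    \<open>DE\<close> and satisfies \<open>2 * D \<le> 2 ^ F\<close>, which absorbs the
    constant.\<close>
  define F where "F = max E E'"
  define m where "m j = f (4 ^ (j + F))" for j
  \<comment> \<open>\<open>int_decode\<close> sends an even number to its half. Truncated
    subtraction replaces a negative numerator by \<open>0\<close>, which only brings the fraction
    closer to the positive \<open>\<alpha>\<close>.\<close>
  define a where "a j = 2 * (k * 4 ^ (j + F) - m j)" for j
  \<comment> \<open>The \<open>- 1\<close> cancels the \<open>Suc\<close> in
    \<open>computable_real\<close>; the product is positive because \<open>m j > 0\<close> and
    \<open>k \<ge> 2\<close>.\<close>
  define b where "b j = (k - 1) * m j - 1" for j
  have m: "computable_nat m" unfolding m_def
    by (intro computable_nat_comp[OF f] computable_intros)
  have "computable_nat a" unfolding a_def by (intro computable_intros m)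
  moreover have "computable_nat b" unfolding b_def by (intro computable_intros m)
  moreover have "\<bar>\<alpha> - of_int (int_decode (a j)) / of_nat (Suc (b j))\<bar> \<le> 1 / 2 ^ j" for j
  proof -
    define e where "e = j + F"
    define n :: real where "n = 4 ^ e"
    define x where "x = real (m j)"
    have "Suc e \<le> 2 ^ e" using less_exp[of e] by (rule Suc_leI)
    then have e2: "real e + 1 \<le> 2 ^ e" by (metis of_nat_Suc of_nat_le_iff of_nat_numeral of_nat_power add.commute)
    have 4: "n = 2 ^ e * 2 ^ e" unfolding n_def by (simp add: power_mult_distrib[symmetric])
    have "real E' \<le> real F" unfolding F_def by simp
    also have "real F \<le> 2 ^ F" using less_exp[of F] by (metis less_imp_le of_nat_le_iff of_nat_numeral of_nat_power)
    finally have F: "2 * D \<le> 2 ^ F" using E' by linarith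
    have err: "\<bar>real k * n - \<omega> * x\<bar> \<le> D * (real e + 1)"
      using DE[of e] unfolding n_def x_def m_def e_def F_def by simp
    have "D * (real e + 1) \<le> D * 2 ^ e" using e2 D by (intro mult_left_mono) auto
    then have err2: "\<bar>real k * n - \<omega> * x\<bar> \<le> D * 2 ^ e" using err by linarith
    have "(2::real) ^ F \<le> 2 ^ e" unfolding e_def by (intro power_increasing) auto
    then have "2 * D \<le> 2 ^ e" using F by linarith
    then have "2 * D * 2 ^ e \<le> n" unfolding 4 by (intro mult_right_mono) auto
    moreover have n0: "0 < n" unfolding n_def by simp
    \<comment> \<open>The error is at most \<open>n / 2\<close>, so
      \<open>\<omega> * x \<ge> k * n / 2\<close>; with \<open>\<omega> \<le> k\<close> this yields
      \<open>n \<le> 2 * x\<close>, which keeps the denominator large.\<close>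
    have "2 * n \<le> real k * n" using k2 n0 by (intro mult_right_mono) auto
    moreover have "0 \<le> x" unfolding x_def by simp
    then have "\<omega> * x \<le> real k * x" using \<omega>(2) by (intro mult_right_mono)
    ultimately have "real k * n \<le> real k * (2 * x)" using err2 n0 by linarith
    then have nx: "n \<le> 2 * x" using k2 by (simp add: mult_le_cancel_left)
    then have x0: "0 < x" using n0 by linarith
    then have mpos: "0 < m j" unfolding x_def by simp
    have k1: "1 \<le> real k - 1" using k2 by simp
    have "Suc (b j) = (k - 1) * m j" unfolding b_def using mpos k2 by simp
    then have den: "real (Suc (b j)) = (real k - 1) * x" using k2 unfolding x_def by (simp add: of_nat_diff)
    have num: "of_int (int_decode (a j)) = real (k * 4 ^ e - m j)"
      unfolding a_def e_def by (simp add: int_decode_def sum_decode_def)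
    define y where "y = (real k * n - x) / ((real k - 1) * x)"
    have p: "0 < (real k - 1) * x" using k1 x0 by simp
    have "y * ((real k - 1) * x) = real k * n - x"
      unfolding y_def by (rule nonzero_eq_divide_eq[THEN iffD1]) (use p in auto)
    then have "(\<alpha> - y) * ((real k - 1) * x) = \<omega> * x - real k * n"
      unfolding \<omega>_def by (simp add: algebra_simps)
    then have "\<alpha> - y = (\<omega> * x - real k * n) / ((real k - 1) * x)"
      using p by (metis less_irrefl nonzero_mult_div_cancel_right)
    then have "\<bar>\<alpha> - y\<bar> = \<bar>\<omega> * x - real k * n\<bar> / ((real k - 1) * x)" using p by (simp add: abs_divide)
    also have "\<dots> \<le> (D * 2 ^ e) / (n / 2)"
    proof (rule frac_le)
      have "1 * x \<le> (real k - 1) * x" using k1 x0 by (intro mult_right_mono) auto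
      then show "n / 2 \<le> (real k - 1) * x" using nx by linarith
    qed (use err2 n0 D in auto)
    also have "\<dots> = 2 * D / 2 ^ e" unfolding 4 by (simp add: field_simps)
    also have "\<dots> \<le> 2 ^ F / 2 ^ e" using F by (intro divide_right_mono) auto
    also have "\<dots> = 1 / 2 ^ j" unfolding e_def by (simp add: power_add)
    finally have y: "\<bar>\<alpha> - y\<bar> \<le> 1 / 2 ^ j" .
    have "real (u - v) = max 0 (real u - real v)" for u v :: nat by linarith
    from this[of "k * 4 ^ e" "m j"] have "real (k * 4 ^ e - m j) = max 0 (real k * n - x)"
      unfolding n_def x_def by simp
    then have "of_int (int_decode (a j)) / of_nat (Suc (b j)) = max 0 y"
      unfolding num den y_def using p by (simp add: max_def divide_le_0_iff zero_le_divide_iff)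
    moreover have "\<bar>\<alpha> - max 0 y\<bar> \<le> \<bar>\<alpha> - y\<bar>" using \<alpha> by (simp add: max_def)
    ultimately show ?thesis using y by linarith
  qed
  ultimately show ?thesis unfolding computable_real_def by blast
qed

end

theorem theorem31:
  fixes U :: "bool list \<Rightarrow> bool list option" and k :: nat and \<alpha> \<beta> :: real
  assumes "optimal_machine U"
    and "k \<ge> 2"
    and "\<alpha> \<in> {0<..<1}" and "\<beta> \<in> {0<..<1}"
    and "\<beta> = real k * \<alpha> / (1 + (real k - 1) * \<alpha>)"
    and "\<not> computable_real \<alpha>" and "\<not> computable_real \<beta>"
  shows "(\<alpha>, \<beta>) \<notin> EXTp U k \<and> (\<alpha>, \<beta>) \<notin> EXT U k"
proof -
  have False if "inj f" "computable_nat f" and \<Gamma>: "\<forall>i\<in>{1..k}. partial_computable (\<Gamma> i)"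
    and "extracts U k \<alpha> \<beta> f \<Gamma> d" for f \<Gamma> d
  proof -
    have "\<forall>i. \<exists>g. i \<in> {1..k} \<longrightarrow> partial_recursive g \<and> (\<forall>s. g (str_code s) = map_option str_code (\<Gamma> i s))"
      using \<Gamma> unfolding partial_computable_def by blast
    then obtain h where h: "\<forall>i. i \<in> {1..k} \<longrightarrow> partial_recursive (h i) \<and>
        (\<forall>s. h i (str_code s) = map_option str_code (\<Gamma> i s))" by (rule choice[THEN exE])
    then have "\<forall>i. \<exists>T. i \<in> {1..k} \<longrightarrow> stages (h i) T" using partial_recursive_stages by blast
    then obtain T where T: "\<forall>i. i \<in> {1..k} \<longrightarrow> stages (h i) (T i)" by (rule choice[THEN exE])
    interpret extractor U k \<alpha> \<beta> f \<Gamma> d h T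
      using assms(1-4) that h T by unfold_locales auto
    have "0 \<le> (real k - 1) * \<alpha>" using assms(2,3) by simp
    then have "\<beta> * (1 + (real k - 1) * \<alpha>) = real k * \<alpha>" using assms(5) by (simp add: field_simps)
    then have "computable_real \<alpha>" by (rule computable_threshold[OF assms(2) \<open>inj f\<close>])
    then show False using assms(6) by blast
  qed
  \<comment> \<open>Total computable functions are in particular partial computable, so the
    contradiction excludes membership in both sets.\<close>
  then show ?thesis unfolding EXTp_def EXT_def total_computable_def by blast
qed

end
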